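(* For every $\delta\in[0,1)$ and every $\alpha\in(\delta/3,1/3)$ there exists $\epsilon>0$ with the following property. For all constants $0<c_1\le c_2$ there are $C>0$ and $n_0$ such that for all $n\ge n_0$, every prime $p$ with $c_1n^\alpha\le p\le c_2 n^\alpha$, every integer $\ell\le n+n^\delta$ and every $(\epsilon\log n)$-local function $f:\{0,1\}^\ell\to\{0,1\}^{n+1}$, $$\Delta\big(f(U),\,(X,\mathrm{majmod}_p(X)\oplus\mathrm{parity}(X))\big)\ \ge\ \tfrac12-\tfrac{C}{\log n},$$ where $U$ is uniform on $\{0,1\}^\ell$ and $X$ is uniform on $\{0,1\}^n$.
   Context: For $x\in\{0,1\}^k$ let $|x|=\sum_i x_i$ be its Hamming weight, $\mathrm{parity}(x)=|x|\bmod 2$, and for an odd prime $p$, $\mathrm{majmod}_p(x)=0$ if $(|x|\bmod p)<p/2$ and $\mathrm{majmod}_p(x)=1$ otherwise (here $a\bmod p\in\{0,\dots,p-1\}$). A function $f:\{0,1\}^\ell\to\{0,1\}^m$ is $d$-local if each output bit depends on at most $d$ input bits. For distributions $D_1,D_2$ on $\{0,1\}^m$, the total variation distance is $\Delta(D_1,D_2)=\max_{T\subseteq\{0,1\}^m}|\Pr[D_1\in T]-\Pr[D_2\in T]|$. $(X,g(X))$ denotes the distribution of the concatenation of $X$ with the bit $g(X)$. *)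

theory Defs
  imports "HOL-Probability.Probability_Mass_Function" "HOL-Computational_Algebra.Primes"
begin

text \<open>Bit strings in {0,1}^k are boolean lists of length k (True = 1).\<close>

definition bitstrings :: "nat \<Rightarrow> bool list set" where
  "bitstrings k = {xs. length xs = k}"

definition hweight :: "bool list \<Rightarrow> nat" where
  "hweight x = length (filter id x)"

definition parity :: "bool list \<Rightarrow> bool" where
  "parity x = odd (hweight x)"

text \<open>majmod_p(x) = 0 iff (|x| mod p) < p/2; written as 2*(|x| mod p) < p.\<close>
definition majmod :: "nat \<Rightarrow> bool list \<Rightarrow> bool" where
  "majmod p x = (\<not> (2 * (hweight x mod p) < p))"

definition uniform_bits :: "nat \<Rightarrow> bool list pmf" where
  "uniform_bits k = pmf_of_set (bitstrings k)"

definition tv_dist :: "'a pmf \<Rightarrow> 'a pmf \<Rightarrow> real" where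
  "tv_dist D1 D2 = (SUP T. \<bar>measure_pmf.prob D1 T - measure_pmf.prob D2 T\<bar>)"

definition is_local :: "real \<Rightarrow> nat \<Rightarrow> nat \<Rightarrow> (bool list \<Rightarrow> bool list) \<Rightarrow> bool" where
  "is_local d l m f \<longleftrightarrow>
     (\<forall>x \<in> bitstrings l. length (f x) = m) \<and>
     (\<forall>i < m. \<exists>S \<subseteq> {..<l}. real (card S) \<le> d \<and>
        (\<forall>x \<in> bitstrings l. \<forall>y \<in> bitstrings l.
           (\<forall>j \<in> S. x ! j = y ! j) \<longrightarrow> f x ! i = f y ! i))"

end

theory Submission
  imports Defs "HOL-Analysis.Complex_Transcendental" "HOL-Real_Asymp.Real_Asymp"
begin

text \<open>
  Strings are identified with the sets of their true positions. If the seed has fewer than \<open>n\<close>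
  bits, the support of the sampler is too small. Otherwise locality yields a set \<open>J\<close> of
  \<open>n / polylog n\<close> seed bits that influence pairwise disjoint blocks of at most \<open>4 d\<close> output bits
  each and do not influence the last bit. Condition on the seed \<open>Y\<close> outside \<open>J\<close>.

  If many bits of \<open>J\<close> are inert (do not change the output), then all such \<open>Y\<close> together
  produce few outputs, since the seed is only slightly longer than \<open>n\<close>. A uniform string vanishes
  on many blocks, so an output vanishing on few of them is suspicious as well. In the remaining
  case many bits of \<open>J\<close> toggle their block between zero and a nonzero string, hence
  change the Hamming weight by a nonzero amount smaller than \<open>p\<close>. If half of these changes
  are even, the weight equidistributes mod \<open>p\<close> while its parity stays fixed; if half are odd, it
  equidistributes mod \<open>2 p\<close>. In both cases the correct last bit is balanced although the
  sampled one is constant, so the sampler errs with probability close to one half.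
\<close>

section \<open>Sums and counts over power sets\<close>

lemma sum_Pow_Un:
  fixes f :: "'a set \<Rightarrow> 'b::comm_monoid_add"
  assumes "finite A" "finite B" "A \<inter> B = {}"
  shows "(\<Sum>X\<in>Pow (A \<union> B). f X) = (\<Sum>Y\<in>Pow A. \<Sum>Z\<in>Pow B. f (Y \<union> Z))"
proof -
  have "(\<Sum>Y\<in>Pow A. \<Sum>Z\<in>Pow B. f (Y \<union> Z)) = (\<Sum>(Y, Z)\<in>Pow A \<times> Pow B. f (Y \<union> Z))"
    by (rule sum.cartesian_product)
  also have "\<dots> = (\<Sum>X\<in>Pow (A \<union> B). f X)"
    using assms(3)
    by (intro sum.reindex_bij_witness[of _ "\<lambda>X. (X \<inter> A, X \<inter> B)" "\<lambda>(Y, Z). Y \<union> Z"]) auto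
  finally show ?thesis by simp
qed

lemma card_Collect_eq_sum:
  assumes "finite S"
  shows "real (card {x\<in>S. P x}) = (\<Sum>x\<in>S. if P x then 1 else 0)"
  using assms by (simp add: sum.If_cases Int_def)

lemma card_Pow_Un:
  assumes "finite A" "finite B" "A \<inter> B = {}"
  shows "real (card {X\<in>Pow (A \<union> B). P X}) = (\<Sum>Y\<in>Pow A. real (card {Z\<in>Pow B. P (Y \<union> Z)}))"
  using assms by (simp only: card_Collect_eq_sum finite_Pow_iff finite_Un sum_Pow_Un simp_thms)

lemma sum_Pow_prod:
  fixes a b :: "'a \<Rightarrow> 'b::comm_semiring_1"
  assumes "finite I"
  shows "(\<Sum>Z\<in>Pow I. \<Prod>i\<in>I. if i \<in> Z then a i else b i) = (\<Prod>i\<in>I. a i + b i)"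
  using assms
proof (induction I)
  case (insert j I)
  have "(\<Sum>Z\<in>Pow (I \<union> {j}). \<Prod>i\<in>insert j I. if i \<in> Z then a i else b i)
      = (\<Sum>Y\<in>Pow I. \<Sum>Z\<in>Pow {j}. \<Prod>i\<in>insert j I. if i \<in> Y \<union> Z then a i else b i)"
    using insert by (intro sum_Pow_Un) auto
  also have "\<dots> = (\<Sum>Y\<in>Pow I. \<Sum>Z\<in>Pow {j}. (if j \<in> Z then a j else b j) * (\<Prod>i\<in>I. if i \<in> Y then a i else b i))"
    using insert by (intro sum.cong refl) (auto intro!: prod.cong arg_cong2[where f="(*)"])
  also have "\<dots> = (a j + b j) * (\<Sum>Y\<in>Pow I. \<Prod>i\<in>I. if i \<in> Y then a i else b i)"
    by (simp add: Pow_insert sum_distrib_left sum.distrib algebra_simps)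
  finally show ?case using insert by simp
qed simp

section \<open>Roots of unity and equidistribution of subset sums\<close>

lemma norm_power_minus_one_le:
  fixes z :: complex
  assumes "norm z = 1"
  shows "norm (z ^ k - 1) \<le> k * norm (z - 1)"
proof (induction k)
  case (Suc k)
  have "z ^ Suc k - 1 = z * (z ^ k - 1) + (z - 1)" by (simp add: algebra_simps)
  then have "norm (z ^ Suc k - 1) \<le> norm (z ^ k - 1) + norm (z - 1)"
    using norm_triangle_ineq[of "z * (z ^ k - 1)" "z - 1"] assms by (simp only: norm_mult mult_1_left)
  then show ?case using Suc by (simp add: algebra_simps)
qed simp

text \<open>The powers of a nontrivial \<open>m\<close>-th root of unity sum to zero, so
  \<open>m\<close> is the sum of \<open>1 - z ^ k\<close> over \<open>k < m\<close>. Each term has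
  norm at most \<open>k\<close> times that of \<open>z - 1\<close>, so the latter cannot be
  small.\<close>

lemma root_of_unity_far_from_one:
  fixes z :: complex
  assumes "z ^ m = 1" "z \<noteq> 1" "m > 0"
  shows "norm (z - 1) \<ge> 2 / m"
proof -
  have n1: "norm z = 1"
    using assms(1,3) power_eq_imp_eq_base[of "norm z" m 1] by (simp add: norm_power[symmetric])
  have "(\<Sum>k<m. z ^ k) = 0"
    using assms by (simp add: sum_gp_strict)
  then have "real m = norm (\<Sum>k<m. 1 - z ^ k)"
    by (simp add: sum_subtractf)
  also have "\<dots> \<le> (\<Sum>k<m. norm (1 - z ^ k))" by (rule norm_sum)
  also have "\<dots> \<le> (\<Sum>k<m. k * norm (z - 1))"
    by (intro sum_mono) (use norm_power_minus_one_le[OF n1] in \<open>simp add: norm_minus_commute\<close>)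
  also have "\<dots> = (\<Sum>k<m. real k) * norm (z - 1)" by (simp add: sum_distrib_right)
  also have "(\<Sum>k<m. real k) = real m * (real m - 1) / 2"
    by (induction m) (auto simp: field_simps)
  also have "real m * (real m - 1) / 2 * norm (z - 1) \<le> real m * (real m / 2 * norm (z - 1))"
    by (simp add: mult_right_mono mult_left_mono algebra_simps)
  finally have "real m * 1 \<le> real m * (real m / 2 * norm (z - 1))" by simp
  then have "1 \<le> real m / 2 * norm (z - 1)" using assms(3) by (simp add: mult_le_cancel_left)
  then show ?thesis using assms(3) by (simp add: field_simps)
qed

text \<open>The parallelogram law turns the distance of at least \<open>2 / m\<close> between
  \<open>u\<close> and \<open>v\<close> into a loss in the norm of \<open>u + v\<close>. The
  exponential form is convenient for multiplying many such factors.\<close>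

lemma norm_add_unit_le_exp:
  fixes u v :: complex and m :: nat
  assumes "norm u = 1" "norm v = 1" "(u / v) ^ m = 1" "u \<noteq> v" "m > 0"
  shows "norm (u + v) \<le> 2 * exp (- 1 / (2 * m\<^sup>2))"
proof -
  have v0: "v \<noteq> 0" using assms(2) by auto
  have "u / v \<noteq> 1" using assms(4) v0 by simp
  then have "2 / m \<le> norm (u / v - 1)" using root_of_unity_far_from_one assms(3,5) by blast
  also have "u / v - 1 = (u - v) / v" using v0 by (simp add: field_simps)
  also have "norm \<dots> = norm (u - v)" using assms(2) by (simp add: norm_divide)
  finally have far: "(2 / m)\<^sup>2 \<le> (norm (u - v))\<^sup>2" by (intro power_mono) auto
  have "(norm (u + v))\<^sup>2 + (norm (u - v))\<^sup>2 = 2 * (norm u)\<^sup>2 + 2 * (norm v)\<^sup>2"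
    unfolding cmod_power2 by (simp add: power2_eq_square algebra_simps)
  then have "(norm (u + v))\<^sup>2 \<le> 4 * (1 - 1 / m\<^sup>2)"
    using far assms by (simp add: power_divide)
  also have "\<dots> \<le> 4 * exp (- 1 / m\<^sup>2)"
    using exp_ge_add_one_self[of "- 1 / m\<^sup>2"] by simp
  also have "\<dots> = (2 * exp (- 1 / (2 * m\<^sup>2)))\<^sup>2"
    by (simp add: power_mult_distrib exp_double[symmetric])
  finally show ?thesis by (rule power2_le_imp_le) simp
qed

text \<open>The standard additive character of the integers mod \<open>m\<close>. The argument is an
  integer so that differences of weights and negative shifts are covered.\<close>

definition unity_root :: "nat \<Rightarrow> int \<Rightarrow> complex" where
  "unity_root m t = cis (2 * pi * t / m)"

lemma unity_root_add: "unity_root m (s + t) = unity_root m s * unity_root m t"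
  unfolding unity_root_def cis_mult by (rule arg_cong[where f=cis]) (simp add: distrib_left add_divide_distrib)

lemma unity_root_power: "unity_root m t ^ k = unity_root m (int k * t)"
  by (simp add: unity_root_def Complex.DeMoivre mult.left_commute)

lemma norm_unity_root [simp]: "norm (unity_root m t) = 1"
  by (simp add: unity_root_def)

lemma unity_root_0 [simp]: "unity_root m 0 = 1"
  by (simp add: unity_root_def)

lemma unity_root_eq_1_iff:
  assumes "m > 0"
  shows "unity_root m t = 1 \<longleftrightarrow> int m dvd t"
proof
  assume "unity_root m t = 1"
  then have "cos (2 * pi * t / m) = 1" by (simp add: unity_root_def complex_eq_iff)
  then obtain k :: int where "2 * pi * t / m = of_int k * 2 * pi" unfolding cos_one_2pi_int by blast
  then have "real_of_int t = of_int (k * int m)" using assms by (simp add: field_simps)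
  then have "t = k * int m" by (simp only: of_int_eq_iff)
  then show "int m dvd t" by simp
next
  assume "int m dvd t"
  then obtain k where "t = int m * k" by blast
  then show "unity_root m t = 1"
    using assms cis_multiple_2pi[of "of_int k"] by (simp add: unity_root_def mult_ac)
qed

lemma unity_root_sum:
  "unity_root m (\<Sum>i\<in>I. g i) = (\<Prod>i\<in>I. unity_root m (g i))"
  by (induction I rule: infinite_finite_induct) (auto simp: unity_root_add)

lemma sum_unity_root:
  assumes "m > 0"
  shows "(\<Sum>k<m. unity_root m (int k * t)) = (if int m dvd t then of_nat m else 0)"
proof (cases "int m dvd t")
  case True
  then have "unity_root m (int k * t) = 1" for k using unity_root_eq_1_iff[OF assms] by simp
  then show ?thesis using True by simp
next
  case False
  then have "unity_root m t \<noteq> 1" using unity_root_eq_1_iff[OF assms] by simp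
  moreover have "unity_root m t ^ m = 1" using unity_root_eq_1_iff[OF assms] by (simp add: unity_root_power)
  ultimately show ?thesis using False by (simp add: unity_root_power[symmetric] sum_gp_strict)
qed

text \<open>Fourier inversion on the integers mod \<open>m\<close>: only the trivial character contributes \<open>1 / m\<close>.\<close>
lemma subset_sum_equidistributed:
  fixes a b :: "'a \<Rightarrow> int" and m :: nat
  assumes I: "finite I" and m: "m > 0" and cop: "\<And>i. i \<in> I \<Longrightarrow> coprime (a i - b i) (int m)"
  shows "real (card {Z\<in>Pow I. int m dvd (\<Sum>i\<in>I. if i \<in> Z then a i else b i) - r})
         \<le> 2 ^ card I * (1 / m + exp (- real (card I) / (2 * m\<^sup>2)))"
proof -
  define W where "W Z = (\<Sum>i\<in>I. if i \<in> Z then a i else b i)" for Z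
  define E where "E = exp (- real (card I) / (2 * m\<^sup>2))"
  let ?S = "{Z\<in>Pow I. int m dvd W Z - r}"
  \<comment> \<open>Each summand of \<open>W Z\<close> depends on a single membership, so the
    character sum over all \<open>Z\<close> factors over \<open>I\<close>.\<close>
  have char: "(\<Sum>Z\<in>Pow I. unity_root m (int k * (W Z - r)))
      = unity_root m (- int k * r) * (\<Prod>i\<in>I. unity_root m (int k * a i) + unity_root m (int k * b i))" for k
  proof -
    have "unity_root m (int k * (W Z - r)) = unity_root m (- int k * r) *
       (\<Prod>i\<in>I. if i \<in> Z then unity_root m (int k * a i) else unity_root m (int k * b i))" for Z
    proof -
      have "int k * (W Z - r) = - int k * r + (\<Sum>i\<in>I. int k * (if i \<in> Z then a i else b i))"
        by (simp add: W_def algebra_simps sum_distrib_left)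
      then show ?thesis
        unfolding \<open>int k * (W Z - r) = _\<close> unity_root_add unity_root_sum
        by (intro arg_cong2[where f="(*)"] prod.cong) auto
    qed
    then show ?thesis by (simp add: sum_distrib_left[symmetric] sum_Pow_prod[OF I])
  qed
  have bound: "norm (\<Sum>Z\<in>Pow I. unity_root m (int k * (W Z - r))) \<le> 2 ^ card I * E"
    if "k \<in> {1..<m}" for k
  proof -
    have "norm (unity_root m (int k * a i) + unity_root m (int k * b i)) \<le> 2 * exp (- 1 / (2 * m\<^sup>2))"
      if i: "i \<in> I" for i
    proof -
      have q: "unity_root m (int k * a i) / unity_root m (int k * b i) = unity_root m (int k * (a i - b i))"
        using unity_root_add[of m "int k * (a i - b i)" "int k * b i"] norm_unity_root[of m "int k * b i"]
        by (auto simp: field_simps simp del: norm_unity_root)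
      \<comment> \<open>Coprimality cancels the difference, and \<open>0 < k < m\<close> excludes
        that \<open>m\<close> divides \<open>k\<close>. So each factor adds two distinct numbers of
        norm 1 and suffers the loss of \<open>norm_add_unit_le_exp\<close>.\<close>
      have "\<not> int m dvd int k * (a i - b i)"
        using cop[OF i] \<open>k \<in> {1..<m}\<close>
        by (simp add: coprime_commute coprime_dvd_mult_left_iff) (auto dest: dvd_imp_le)
      then have "unity_root m (int k * (a i - b i)) \<noteq> 1" using unity_root_eq_1_iff[OF m] by simp
      then have ne: "unity_root m (int k * a i) \<noteq> unity_root m (int k * b i)"
        using q by (metis norm_unity_root div_self norm_zero zero_neq_one)
      show ?thesis
        by (rule norm_add_unit_le_exp[OF _ _ _ ne m])
           (simp_all add: q unity_root_power unity_root_eq_1_iff[OF m])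
    qed
    then have "(\<Prod>i\<in>I. norm (unity_root m (int k * a i) + unity_root m (int k * b i)))
        \<le> (\<Prod>i\<in>I. 2 * exp (- 1 / (2 * m\<^sup>2)))"
      by (intro prod_mono) auto
    then show ?thesis
      unfolding char E_def norm_mult prod_norm[symmetric]
      by (simp add: power_mult_distrib exp_of_nat_mult[symmetric])
  qed
  have "real m * card ?S = norm (\<Sum>Z\<in>Pow I. if int m dvd W Z - r then of_nat m else (0::complex))"
    using I by (simp add: sum.If_cases Int_def norm_mult)
  also have "\<dots> = norm (\<Sum>Z\<in>Pow I. \<Sum>k<m. unity_root m (int k * (W Z - r)))"
    by (simp add: sum_unity_root[OF m])
  also have "\<dots> = norm (\<Sum>k<m. \<Sum>Z\<in>Pow I. unity_root m (int k * (W Z - r)))"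
    by (subst sum.swap) simp
  also have "\<dots> \<le> (\<Sum>k<m. norm (\<Sum>Z\<in>Pow I. unity_root m (int k * (W Z - r))))"
    by (rule norm_sum)
  also have "\<dots> \<le> (\<Sum>k<m. if k = 0 then 2 ^ card I else 2 ^ card I * E)"
  proof (intro sum_mono)
    fix k assume "k \<in> {..<m}"
    then show "norm (\<Sum>Z\<in>Pow I. unity_root m (int k * (W Z - r))) \<le> (if k = 0 then 2 ^ card I else 2 ^ card I * E)"
      using bound[of k] I by (cases "k = 0") (simp_all add: card_Pow norm_power)
  qed
  also have "\<dots> \<le> (\<Sum>k<m. (if k = 0 then 2 ^ card I else 0) + 2 ^ card I * E)"
    by (intro sum_mono) (auto simp: E_def)
  also have "\<dots> = 2 ^ card I + real m * (2 ^ card I * E)"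
    using m by (simp add: sum.distrib)
  finally have "card ?S \<le> 2 ^ card I * (1 / m + E)"
    using m by (simp add: field_simps)
  then show ?thesis by (simp add: W_def E_def)
qed

section \<open>Blocks avoided by a uniform set\<close>

text \<open>A uniform \<open>X\<close> meets disjoint blocks independently, so the average factors
  over the blocks. Only one of the \<open>2 ^ card (B j)\<close> traces on \<open>B j\<close> is
  empty, and it halves the summand; hence the factor of at most \<open>1 - q / 2\<close>. The
  induction peels off one block and continues on \<open>N - B j\<close>.\<close>

lemma sum_half_power_avoided_blocks:
  fixes B :: "'j \<Rightarrow> 'b set" and q :: real
  assumes "finite J" "finite N" "\<And>j. j \<in> J \<Longrightarrow> B j \<subseteq> N"
    and "\<And>i j. i \<in> J \<Longrightarrow> j \<in> J \<Longrightarrow> i \<noteq> j \<Longrightarrow> B i \<inter> B j = {}"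
    and "\<And>j. j \<in> J \<Longrightarrow> q \<le> (1/2) ^ card (B j)" and "0 \<le> q" "q \<le> 1"
  shows "(\<Sum>X\<in>Pow N. (1/2) ^ card {j\<in>J. X \<inter> B j = {}}) \<le> 2 ^ card N * (1 - q / 2) ^ card J"
  using assms(1-5)
proof (induction J arbitrary: N)
  case empty
  then show ?case by (simp add: card_Pow)
next
  case (insert j J)
  have fB: "finite (B j)" using insert.prems by (meson finite_subset insertI1)
  have BN: "B j \<subseteq> N" using insert.prems by blast
  have N: "N = (N - B j) \<union> B j" using BN by auto
  have cN: "card N = card (N - B j) + card (B j)"
    using BN fB insert.prems(1) by (metis card_Diff_subset card_mono le_add_diff_inverse2)
  let ?c = "\<lambda>X. (1/2::real) ^ card {i\<in>J. X \<inter> B i = {}}"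
  have "(\<Sum>X\<in>Pow N. (1/2::real) ^ card {i\<in>insert j J. X \<inter> B i = {}})
     = (\<Sum>Y\<in>Pow (N - B j). \<Sum>Z\<in>Pow (B j). (1/2) ^ card {i\<in>insert j J. (Y \<union> Z) \<inter> B i = {}})"
    using fB insert.prems(1) by (subst N, intro sum_Pow_Un) auto
  also have "\<dots> = (\<Sum>Y\<in>Pow (N - B j). \<Sum>Z\<in>Pow (B j). (if Z = {} then 1/2 else 1) * ?c Y)"
  proof (intro sum.cong refl)
    fix Y Z assume Y: "Y \<in> Pow (N - B j)" and Z: "Z \<in> Pow (B j)"
    have "(Y \<union> Z) \<inter> B i = Y \<inter> B i" if "i \<in> J" for i
    proof -
      have "B i \<inter> B j = {}" using insert.prems(3)[of i j] insert.hyps that by auto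
      then show ?thesis using Z by blast
    qed
    then have "{i\<in>insert j J. (Y \<union> Z) \<inter> B i = {}} = (if Z = {} then insert j {i\<in>J. Y \<inter> B i = {}} else {i\<in>J. Y \<inter> B i = {}})"
      using Y Z by auto
    then show "(1/2::real) ^ card {i\<in>insert j J. (Y \<union> Z) \<inter> B i = {}} = (if Z = {} then 1/2 else 1) * ?c Y"
      using insert.hyps by simp
  qed
  also have "\<dots> = (\<Sum>Z\<in>Pow (B j). if Z = {} then 1/2 else 1) * (\<Sum>Y\<in>Pow (N - B j). ?c Y)"
    by (subst sum_product, subst sum.swap) simp
  also have "(\<Sum>Z\<in>Pow (B j). if Z = {} then 1/2 else 1) = 2 ^ card (B j) - (1/2::real)"
  proof -
    have "(\<Sum>Z\<in>Pow (B j). if Z = {} then 1/2 else (1::real)) = (\<Sum>Z\<in>Pow (B j). 1 - (if Z = {} then 1/2 else 0))"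
      by (intro sum.cong) auto
    also have "\<dots> = 2 ^ card (B j) - 1/2" using fB by (simp add: sum_subtractf card_Pow)
    finally show ?thesis .
  qed
  also have "(2 ^ card (B j) - (1/2::real)) * (\<Sum>Y\<in>Pow (N - B j). ?c Y)
     \<le> (2 ^ card (B j) * (1 - q / 2)) * (2 ^ card (N - B j) * (1 - q / 2) ^ card J)"
  proof (intro mult_mono)
    have "q \<le> (1/2) ^ card (B j)" using insert.prems by simp
    then have "q * 2 ^ card (B j) \<le> 1" by (simp add: power_divide field_simps)
    then show "2 ^ card (B j) - 1/2 \<le> 2 ^ card (B j) * (1 - q / 2)" by (simp add: algebra_simps)
    show "(\<Sum>Y\<in>Pow (N - B j). ?c Y) \<le> 2 ^ card (N - B j) * (1 - q / 2) ^ card J"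
    proof (rule insert.IH)
      fix i assume i: "i \<in> J"
      then have "B i \<inter> B j = {}" using insert.prems(3)[of i j] insert.hyps by auto
      then show "B i \<subseteq> N - B j" using insert.prems(2)[of i] i by blast
    qed (use insert.prems in auto)
  qed (use assms in \<open>auto intro!: sum_nonneg\<close>)
  also have "\<dots> = 2 ^ card N * (1 - q / 2) ^ card (insert j J)"
    using insert.hyps by (simp add: cN power_add mult_ac)
  finally show ?case .
qed

text \<open>Markov's inequality for \<open>2\<close> to the minus the number of blocks avoided by \<open>X\<close>.\<close>
lemma card_few_avoided_blocks:
  fixes B :: "'j \<Rightarrow> 'b set" and q \<theta> :: real
  assumes "finite J" "finite N" "\<And>j. j \<in> J \<Longrightarrow> B j \<subseteq> N"
    and "\<And>i j. i \<in> J \<Longrightarrow> j \<in> J \<Longrightarrow> i \<noteq> j \<Longrightarrow> B i \<inter> B j = {}"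
    and "\<And>j. j \<in> J \<Longrightarrow> q \<le> (1/2) ^ card (B j)" and q: "0 \<le> q" "q \<le> 1"
    and \<theta>: "\<theta> \<le> q * card J / 4"
  shows "real (card {X\<in>Pow N. real (card {j\<in>J. X \<inter> B j = {}}) < \<theta>}) \<le> 2 ^ card N * exp (- q * card J / 4)"
proof -
  let ?c = "\<lambda>X. card {j\<in>J. X \<inter> B j = {}}"
  have "2 powr (- \<theta>) * card {X\<in>Pow N. real (?c X) < \<theta>} = (\<Sum>X\<in>Pow N. if real (?c X) < \<theta> then 2 powr (- \<theta>) else 0)"
    using assms(2) by (simp add: sum.If_cases Int_def)
  also have "\<dots> \<le> (\<Sum>X\<in>Pow N. (1/2) ^ ?c X)"
  proof (intro sum_mono)
    fix X
    have "2 powr (- \<theta>) \<le> (1/2::real) ^ ?c X" if "real (?c X) < \<theta>"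
    proof -
      have "(1/2::real) ^ ?c X = 2 powr (- real (?c X))"
        by (simp add: powr_minus powr_realpow power_one_over inverse_eq_divide)
      then show ?thesis using that by simp
    qed
    then show "(if real (?c X) < \<theta> then 2 powr (- \<theta>) else 0) \<le> (1/2) ^ ?c X" by simp
  qed
  also have "\<dots> \<le> 2 ^ card N * (1 - q / 2) ^ card J"
    by (rule sum_half_power_avoided_blocks[OF assms(1-7)])
  also have "\<dots> \<le> 2 ^ card N * exp (- q / 2) ^ card J"
    using q exp_ge_add_one_self[of "- q / 2"] by (intro mult_left_mono power_mono) auto
  also have "\<dots> = 2 ^ card N * exp (- q * card J / 2)"
    by (simp add: exp_of_nat_mult[symmetric] mult_ac)
  finally have A: "card {X\<in>Pow N. real (?c X) < \<theta>} \<le> 2 ^ card N * exp (- q * card J / 2) * 2 powr \<theta>"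
    by (simp add: powr_minus field_simps)
  \<comment> \<open>Undoing the Markov weight costs \<open>2 powr \<theta>\<close>. By
    \<open>2 \<le> exp 1\<close> this uses up at most half of the exponent gained so far.\<close>
  have "2 powr \<theta> \<le> 2 powr (q * card J / 4)" using \<theta> by simp
  also have "\<dots> \<le> exp 1 powr (q * card J / 4)"
    using q exp_ge_add_one_self[of 1] by (intro powr_mono2) auto
  also have "\<dots> = exp (q * card J / 4)" by (simp add: powr_def)
  finally have "2 ^ card N * exp (- q * card J / 2) * 2 powr \<theta> \<le> 2 ^ card N * exp (- q * card J / 2) * exp (q * card J / 4)"
    by (intro mult_left_mono) auto
  also have "\<dots> = 2 ^ card N * exp (- q * card J / 4)"
    by (simp add: mult.assoc exp_add[symmetric])
  finally show ?thesis using A by linarith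
qed

section \<open>Independent sets in graphs of bounded degree\<close>

text \<open>In an independent set of maximum size nothing can be added, so every vertex outside has
  a neighbour inside. The closed neighbourhoods of its members, of size at most
  \<open>\<Delta> + 1\<close>, therefore cover \<open>V\<close>.\<close>

lemma independent_set_exists:
  fixes R :: "'a \<Rightarrow> 'a \<Rightarrow> bool" and \<Delta> :: real
  assumes V: "finite V" and R: "symp R"
    and deg: "\<And>v. v \<in> V \<Longrightarrow> real (card {w\<in>V. R v w}) \<le> \<Delta>"
  obtains J where "J \<subseteq> V" "\<And>i j. i \<in> J \<Longrightarrow> j \<in> J \<Longrightarrow> i \<noteq> j \<Longrightarrow> \<not> R i j"
    "real (card V) \<le> real (card J) * (\<Delta> + 1)"
proof -
  define P where "P J \<longleftrightarrow> J \<subseteq> V \<and> (\<forall>i\<in>J. \<forall>j\<in>J. i \<noteq> j \<longrightarrow> \<not> R i j)" for J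
  have "P {}" by (simp add: P_def)
  moreover have "\<forall>J. P J \<longrightarrow> card J < card V + 1" using V by (auto simp: P_def less_Suc_eq_le intro: card_mono)
  ultimately obtain J where J: "P J" and max: "\<And>J'. P J' \<Longrightarrow> card J' \<le> card J"
    using ex_has_greatest_nat[of P "{}" card "card V + 1"] by auto
  have JV: "J \<subseteq> V" "finite J" using J V by (auto simp: P_def intro: finite_subset)
  have "V \<subseteq> (\<Union>j\<in>J. insert j {w\<in>V. R j w})"
  proof
    fix v assume v: "v \<in> V"
    show "v \<in> (\<Union>j\<in>J. insert j {w\<in>V. R j w})"
    proof (cases "v \<in> J")
      case False
      then have "\<not> P (insert v J)" using max[of "insert v J"] JV by auto
      then obtain j where "j \<in> J" "R j v" using J v R by (auto simp: P_def dest: sympD)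
      then show ?thesis using v by auto
    qed auto
  qed
  then have "real (card V) \<le> real (card (\<Union>j\<in>J. insert j {w\<in>V. R j w}))"
    using JV V by (intro of_nat_mono card_mono) auto
  also have "\<dots> \<le> real (\<Sum>j\<in>J. card (insert j {w\<in>V. R j w}))"
    using JV by (intro of_nat_mono card_UN_le) auto
  also have "\<dots> \<le> (\<Sum>j\<in>J. \<Delta> + 1)"
    unfolding of_nat_sum
  proof (intro sum_mono)
    fix j assume "j \<in> J"
    then have "real (card {w\<in>V. R j w}) \<le> \<Delta>" using deg JV by auto
    moreover have "card (insert j {w\<in>V. R j w}) \<le> card {w\<in>V. R j w} + 1"
      using V by (simp add: card_insert_if)
    ultimately show "real (card (insert j {w\<in>V. R j w})) \<le> \<Delta> + 1" by linarith
  qed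
  finally show thesis using J by (intro that[of J]) (auto simp: P_def)
qed

section \<open>Majority mod \<open>p\<close> and parity of random weights\<close>

text \<open>For odd \<open>p\<close> the two classes have sizes \<open>(p + 1) / 2\<close> and
  \<open>(p - 1) / 2\<close>. This imbalance is the source of the term \<open>1 / (2 * p)\<close> in
  the later bounds.\<close>

lemma card_majmod_residues:
  fixes p :: nat
  assumes "p > 0"
  shows "2 * card {r\<in>{..<p}. (2 * r < p) = v} \<le> p + 1"
proof (cases v)
  case True
  have "{r\<in>{..<p}. (2 * r < p) = v} \<subseteq> {..<(p + 1) div 2}" using True by auto
  from card_mono[OF _ this] show ?thesis by simp
next
  case False
  have "{r\<in>{..<p}. (2 * r < p) = v} \<subseteq> {(p + 1) div 2..<p}" using False by auto
  from card_mono[OF _ this] show ?thesis by simp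
qed

text \<open>For odd \<open>p\<close> the residues \<open>r\<close> and \<open>r + p\<close> mod \<open>2 * p\<close> agree mod \<open>p\<close> and differ in parity.\<close>
lemma card_majmod_parity_residues:
  fixes p :: nat
  assumes "odd p"
  shows "card {r\<in>{..<2 * p}. ((2 * (r mod p) < p) = odd r) = v} = p"
proof -
  define Q where "Q r \<longleftrightarrow> ((2 * (r mod p) < p) = odd r) = v" for r
  have p: "p > 0" using assms by (auto intro: Nat.gr0I)
  have "{r\<in>{..<2 * p}. Q r} = {r\<in>{..<p}. Q r} \<union> (\<lambda>r. r + p) ` {r\<in>{..<p}. \<not> Q r}"
  proof (intro equalityI subsetI)
    fix r assume r: "r \<in> {r\<in>{..<2 * p}. Q r}"
    show "r \<in> {r\<in>{..<p}. Q r} \<union> (\<lambda>r. r + p) ` {r\<in>{..<p}. \<not> Q r}"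
    proof (cases "r < p")
      case False
      then have "r = (r - p) + p" "(r - p) mod p = r mod p" "odd (r - p) \<noteq> odd r"
        using assms by (auto simp: le_mod_geq)
      moreover have "r - p < p" using r False by auto
      ultimately have "\<not> Q (r - p)" using r by (auto simp: Q_def)
      then show ?thesis using r False by (intro UnI2 image_eqI[of _ _ "r - p"]) auto
    qed (use r in auto)
  next
    fix r assume "r \<in> {r\<in>{..<p}. Q r} \<union> (\<lambda>r. r + p) ` {r\<in>{..<p}. \<not> Q r}"
    then show "r \<in> {r\<in>{..<2 * p}. Q r}" using assms by (auto simp: Q_def)
  qed
  also have "card \<dots> = card {r\<in>{..<p}. Q r} + card ((\<lambda>r. r + p) ` {r\<in>{..<p}. \<not> Q r})"
    by (rule card_Un_disjoint) auto
  also have "card ((\<lambda>r. r + p) ` {r\<in>{..<p}. \<not> Q r}) = card {r\<in>{..<p}. \<not> Q r}"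
    by (rule card_image) simp
  also have "card {r\<in>{..<p}. Q r} + card {r\<in>{..<p}. \<not> Q r} = card ({r\<in>{..<p}. Q r} \<union> {r\<in>{..<p}. \<not> Q r})"
    by (rule card_Un_disjoint[symmetric]) auto
  also have "{r\<in>{..<p}. Q r} \<union> {r\<in>{..<p}. \<not> Q r} = {..<p}" by auto
  finally show ?thesis by (simp add: Q_def)
qed

text \<open>A union bound over the residues in \<open>S\<close>, which pays the exponential error at
  most \<open>m\<close> times. The offset \<open>c\<close> only shifts the residue aimed at.\<close>

lemma card_subset_sum_residues:
  fixes a b :: "'a \<Rightarrow> nat" and m c :: nat
  assumes I: "finite I" and m: "m > 0"
    and cop: "\<And>i. i \<in> I \<Longrightarrow> coprime (int (a i) - int (b i)) (int m)" and S: "S \<subseteq> {..<m}"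
  shows "real (card {Z\<in>Pow I. (c + (\<Sum>i\<in>I. if i \<in> Z then a i else b i)) mod m \<in> S})
         \<le> 2 ^ card I * (card S / m + m * exp (- real (card I) / (2 * m\<^sup>2)))"
proof -
  define W where "W Z = c + (\<Sum>i\<in>I. if i \<in> Z then a i else b i)" for Z
  let ?E = "exp (- real (card I) / (2 * m\<^sup>2))"
  have fS: "finite S" using S finite_subset by blast
  have cS: "card S \<le> m" using card_mono[OF _ S] by simp
  have one: "real (card {Z\<in>Pow I. W Z mod m = r}) \<le> 2 ^ card I * (1 / m + ?E)" if "r \<in> S" for r
  proof -
    have "W Z mod m = r \<longleftrightarrow> int m dvd (\<Sum>i\<in>I. if i \<in> Z then int (a i) else int (b i)) - (int r - int c)" for Z
    proof -
      have "r < m" using S that by auto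
      then have "W Z mod m = r \<longleftrightarrow> int (W Z) mod int m = int r mod int m"
        by (metis mod_less of_nat_mod of_nat_eq_iff)
      also have "\<dots> \<longleftrightarrow> int m dvd int (W Z) - int r" by (rule mod_eq_dvd_iff)
      also have "int (W Z) - int r = (\<Sum>i\<in>I. if i \<in> Z then int (a i) else int (b i)) - (int r - int c)"
        by (simp add: W_def if_distrib cong: if_cong)
      finally show ?thesis .
    qed
    then show ?thesis using subset_sum_equidistributed[OF I m cop] by simp
  qed
  have "{Z\<in>Pow I. W Z mod m \<in> S} = (\<Union>r\<in>S. {Z\<in>Pow I. W Z mod m = r})" by auto
  then have "real (card {Z\<in>Pow I. W Z mod m \<in> S}) \<le> real (\<Sum>r\<in>S. card {Z\<in>Pow I. W Z mod m = r})"
    using card_UN_le[OF fS, of "\<lambda>r. {Z\<in>Pow I. W Z mod m = r}"] by (simp only: of_nat_le_iff)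
  also have "\<dots> \<le> (\<Sum>r\<in>S. 2 ^ card I * (1 / m + ?E))"
    unfolding of_nat_sum by (intro sum_mono one)
  also have "\<dots> = 2 ^ card I * (card S / m + card S * ?E)" by (simp add: field_simps)
  also have "\<dots> \<le> 2 ^ card I * (card S / m + m * ?E)"
    using cS by (intro mult_left_mono add_left_mono mult_right_mono) auto
  finally show ?thesis by (simp add: W_def)
qed

text \<open>The correct last bit as a function of the Hamming weight alone; \<open>\<noteq>\<close>
  on booleans is exclusive or.\<close>

definition majpar :: "nat \<Rightarrow> nat \<Rightarrow> bool" where
  "majpar p w \<longleftrightarrow> (\<not> 2 * (w mod p) < p) \<noteq> odd w"

text \<open>Even changes freeze the parity of the weight, so the event becomes a condition on the
  weight mod \<open>p\<close>, met by about half of the residues.\<close>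

lemma card_majpar_le_even:
  fixes a b :: "'a \<Rightarrow> nat" and p c :: nat
  assumes I: "finite I" and p: "p > 0"
    and cop: "\<And>i. i \<in> I \<Longrightarrow> coprime (int (a i) - int (b i)) (int p)"
    and ev: "\<And>i. i \<in> I \<Longrightarrow> even (a i + b i)"
  shows "real (card {Z\<in>Pow I. majpar p (c + (\<Sum>i\<in>I. if i \<in> Z then a i else b i)) = v})
         \<le> 2 ^ card I * (1 / 2 + 1 / (2 * p) + p * exp (- real (card I) / (2 * p\<^sup>2)))"
proof -
  define W where "W Z = c + (\<Sum>i\<in>I. if i \<in> Z then a i else b i)" for Z
  have par: "odd (W Z) = odd (W {})" for Z
    unfolding W_def
  proof -
    \<comment> \<open>In this comparison with the empty set, an index contributes
      \<open>a i + b i\<close> or twice \<open>b i\<close>, both even.\<close>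
    have "even ((\<Sum>i\<in>I. if i \<in> Z then a i else b i) + (\<Sum>i\<in>I. if i \<in> {} then a i else b i))"
      unfolding sum.distrib[symmetric] using ev by (intro dvd_sum) auto
    then show "odd (c + (\<Sum>i\<in>I. if i \<in> Z then a i else b i)) = odd (c + (\<Sum>i\<in>I. if i \<in> {} then a i else b i))"
      by auto
  qed
  let ?S = "{r\<in>{..<p}. (2 * r < p) = (v = odd (W {}))}"
  have "majpar p (W Z) = v \<longleftrightarrow> W Z mod p \<in> ?S" for Z
    using p par[of Z] by (auto simp: majpar_def)
  then have eq: "{Z\<in>Pow I. majpar p (W Z) = v} = {Z\<in>Pow I. W Z mod p \<in> ?S}"
    by blast
  have "real (card {Z\<in>Pow I. majpar p (W Z) = v})
     \<le> 2 ^ card I * (card ?S / p + p * exp (- real (card I) / (2 * p\<^sup>2)))"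
    unfolding eq
    using card_subset_sum_residues[where a=a and b=b and S="?S" and c=c, OF I p cop]
    by (auto simp only: W_def[symmetric])
  also have "\<dots> \<le> 2 ^ card I * (1 / 2 + 1 / (2 * p) + p * exp (- real (card I) / (2 * p\<^sup>2)))"
  proof (intro mult_left_mono add_right_mono)
    have "2 * card ?S \<le> p + 1" by (rule card_majmod_residues[OF p])
    then have "2 * real (card ?S) \<le> real p + 1" by linarith
    then show "card ?S / p \<le> 1 / 2 + 1 / (2 * p)" using p by (simp add: field_simps)
  qed simp
  finally show ?thesis by (simp add: W_def)
qed

text \<open>Odd differences coprime to \<open>p\<close> are coprime to \<open>2 * p\<close>, so the
  weight equidistributes mod \<open>2 * p\<close>, where exactly half of the residues give the value
  \<open>v\<close>.\<close>

lemma card_majpar_le_odd: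
  fixes a b :: "'a \<Rightarrow> nat" and p c :: nat
  assumes I: "finite I" and p: "odd p"
    and cop: "\<And>i. i \<in> I \<Longrightarrow> coprime (int (a i) - int (b i)) (int p)"
    and od: "\<And>i. i \<in> I \<Longrightarrow> odd (a i + b i)"
  shows "real (card {Z\<in>Pow I. majpar p (c + (\<Sum>i\<in>I. if i \<in> Z then a i else b i)) = v})
         \<le> 2 ^ card I * (1 / 2 + 2 * p * exp (- real (card I) / (8 * p\<^sup>2)))"
proof -
  define W where "W Z = c + (\<Sum>i\<in>I. if i \<in> Z then a i else b i)" for Z
  let ?S = "{r\<in>{..<2 * p}. ((2 * (r mod p) < p) = odd r) = v}"
  have p0: "p > 0" using p by (auto intro: Nat.gr0I)
  \<comment> \<open>The residue mod \<open>2 * p\<close> determines both the residue mod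
    \<open>p\<close> and the parity.\<close>
  have "majpar p w = v \<longleftrightarrow> w mod (2 * p) \<in> ?S" for w
  proof -
    have "w mod (2 * p) mod p = w mod p" by (simp add: mod_mod_cancel)
    moreover have "odd (w mod (2 * p)) = odd w" by (simp add: dvd_mod_iff)
    ultimately show ?thesis using p0 by (auto simp: majpar_def)
  qed
  then have eq: "{Z\<in>Pow I. majpar p (W Z) = v} = {Z\<in>Pow I. W Z mod (2 * p) \<in> ?S}"
    by blast
  have cop': "coprime (int (a i) - int (b i)) (int (2 * p))" if "i \<in> I" for i
    using cop[OF that] od[OF that] by simp
  have "real (card {Z\<in>Pow I. majpar p (W Z) = v})
     \<le> 2 ^ card I * (card ?S / (2 * p) + (2 * p) * exp (- real (card I) / (2 * (2 * p)\<^sup>2)))"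
    unfolding eq
    using card_subset_sum_residues[where a=a and b=b and S="?S" and c=c, OF I _ cop'] p0
    by (auto simp: W_def[symmetric])
  also have "card ?S = p" by (rule card_majmod_parity_residues[OF p])
  finally show ?thesis using p0 by (simp add: W_def power_mult_distrib)
qed

text \<open>Useful differences are known only on \<open>K\<close>. One parity class of these
  differences holds at least half of \<open>K\<close>, and randomness in that class suffices: all
  other choices are fixed and absorbed into the constant \<open>c\<close>.\<close>

lemma card_majpar_le:
  fixes a b :: "'a \<Rightarrow> nat" and p c :: nat
  assumes J: "finite J" and p: "odd p" and K: "K \<subseteq> J"
    and cop: "\<And>i. i \<in> K \<Longrightarrow> coprime (int (a i) - int (b i)) (int p)"
  shows "real (card {Z\<in>Pow J. majpar p (c + (\<Sum>i\<in>J. if i \<in> Z then a i else b i)) = v})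
         \<le> 2 ^ card J * (1 / 2 + 1 / (2 * p) + 2 * p * exp (- real (card K) / (16 * p\<^sup>2)))"
proof -
  define W where "W I Z = (\<Sum>i\<in>I. if i \<in> Z then a i else b i)" for I Z
  define e where "e = 1 / 2 + 1 / (2 * p) + 2 * p * exp (- real (card K) / (16 * p\<^sup>2))"
  have p0: "p > 0" using p by (auto intro: Nat.gr0I)
  have fK: "finite K" using J K finite_subset by blast
  define K0 where "K0 = {i\<in>K. even (a i + b i)}"
  define K1 where "K1 = {i\<in>K. odd (a i + b i)}"
  have "K = K0 \<union> K1" "K0 \<inter> K1 = {}" by (auto simp: K0_def K1_def)
  then have cK: "card K = card K0 + card K1" using fK by (metis card_Un_disjoint finite_Un)
  \<comment> \<open>The bound has to be uniform in \<open>c\<close>, because the indices outside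
    \<open>I\<close> will shift it. The \<open>16\<close> in \<open>e\<close> comes from the odd
    case, where half of \<open>K\<close> meets the denominator \<open>8\<close> of the modulus
    \<open>2 * p\<close>; the even case does better.\<close>
  have "\<exists>I\<subseteq>J. \<forall>c. real (card {Z\<in>Pow I. majpar p (c + W I Z) = v}) \<le> 2 ^ card I * e"
  proof (cases "card K \<le> 2 * card K0")
    case True
    have "real (card {Z\<in>Pow K0. majpar p (c + W K0 Z) = v})
         \<le> 2 ^ card K0 * (1 / 2 + 1 / (2 * p) + p * exp (- real (card K0) / (2 * p\<^sup>2)))" for c
      unfolding W_def by (rule card_majpar_le_even) (use fK p0 cop in \<open>auto simp: K0_def\<close>)
    moreover have "2 ^ card K0 * (1 / 2 + 1 / (2 * p) + p * exp (- real (card K0) / (2 * p\<^sup>2))) \<le> 2 ^ card K0 * e"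
      unfolding e_def
    proof (intro mult_left_mono add_left_mono mult_mono)
      have "real (card K) / (16 * p\<^sup>2) \<le> (2 * real (card K0)) / (4 * p\<^sup>2)"
        using True p0 by (intro frac_le) auto
      then show "exp (- real (card K0) / (2 * p\<^sup>2)) \<le> exp (- real (card K) / (16 * p\<^sup>2))" by simp
    qed auto
    ultimately show ?thesis using K by (intro exI[of _ K0]) (fastforce simp: K0_def intro: order_trans)
  next
    case False
    have "real (card {Z\<in>Pow K1. majpar p (c + W K1 Z) = v})
         \<le> 2 ^ card K1 * (1 / 2 + 2 * p * exp (- real (card K1) / (8 * p\<^sup>2)))" for c
      unfolding W_def by (rule card_majpar_le_odd) (use fK p cop in \<open>auto simp: K1_def\<close>)
    moreover have "2 ^ card K1 * (1 / 2 + 2 * p * exp (- real (card K1) / (8 * p\<^sup>2))) \<le> 2 ^ card K1 * e"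
      unfolding e_def
    proof (intro mult_left_mono add_mono mult_mono)
      have "real (card K) / (16 * p\<^sup>2) \<le> (2 * real (card K1)) / (16 * p\<^sup>2)"
        using False p0 cK by (intro divide_right_mono) auto
      then show "exp (- real (card K1) / (8 * p\<^sup>2)) \<le> exp (- real (card K) / (16 * p\<^sup>2))" by simp
    qed auto
    ultimately show ?thesis using K by (intro exI[of _ K1]) (fastforce simp: K1_def intro: order_trans)
  qed
  then obtain I where I: "I \<subseteq> J" and le: "\<And>c. real (card {Z\<in>Pow I. majpar p (c + W I Z) = v}) \<le> 2 ^ card I * e"
    by blast
  have fI: "finite I" using I J finite_subset by blast
  have JI: "J = (J - I) \<union> I" using I by auto
  have "real (card {Z\<in>Pow J. majpar p (c + W J Z) = v})
      = (\<Sum>V\<in>Pow (J - I). real (card {Z\<in>Pow I. majpar p (c + W J (V \<union> Z)) = v}))"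
    using card_Pow_Un[of "J - I" I "\<lambda>Z. majpar p (c + W J Z) = v"] fI J JI by auto
  also have "\<dots> = (\<Sum>V\<in>Pow (J - I). real (card {Z\<in>Pow I. majpar p ((c + W (J - I) V) + W I Z) = v}))"
  proof (intro sum.cong refl arg_cong[where f=real] arg_cong[where f=card] Collect_cong conj_cong)
    fix V Z assume "V \<in> Pow (J - I)" "Z \<in> Pow I"
    have "W J (V \<union> Z) = W (J - I) (V \<union> Z) + W I (V \<union> Z)"
      unfolding W_def using J I by (rule sum.subset_diff[rotated 1])
    also have "W (J - I) (V \<union> Z) = W (J - I) V"
      unfolding W_def using \<open>Z \<in> Pow I\<close> by (intro sum.cong) auto
    also have "W I (V \<union> Z) = W I Z"
      unfolding W_def using \<open>V \<in> Pow (J - I)\<close> by (intro sum.cong) auto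
    finally show "majpar p (c + W J (V \<union> Z)) = v \<longleftrightarrow> majpar p ((c + W (J - I) V) + W I Z) = v"
      by (simp add: add.assoc)
  qed
  also have "\<dots> \<le> (\<Sum>V\<in>Pow (J - I). 2 ^ card I * e)" by (intro sum_mono le)
  also have "\<dots> = 2 ^ card J * e"
  proof -
    have "card J = card (J - I) + card I" using I J fI by (metis card_Diff_subset card_mono le_add_diff_inverse2)
    then show ?thesis using J by (simp add: card_Pow power_add)
  qed
  finally show ?thesis by (simp add: W_def e_def)
qed

section \<open>Local maps on seeds and outputs encoded as sets\<close>

text \<open>Output position \<open>i\<close> reads only the seed positions in \<open>D i\<close>,
  and no output position reads two members of \<open>J\<close>. Once the seed outside
  \<open>J\<close> is fixed, the members of \<open>J\<close> act as independent switches on disjoint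
  blocks of the output.\<close>

locale fibred_map =
  fixes L :: "'a set" and N :: "'b set" and F :: "'a set \<Rightarrow> 'b set" and D :: "'b \<Rightarrow> 'a set" and J :: "'a set"
  assumes finite_L: "finite L" and finite_N: "finite N"
    and F_subset: "\<And>A. A \<subseteq> L \<Longrightarrow> F A \<subseteq> N"
    and F_local: "\<And>i A A'. i \<in> N \<Longrightarrow> A \<subseteq> L \<Longrightarrow> A' \<subseteq> L \<Longrightarrow> A \<inter> D i = A' \<inter> D i \<Longrightarrow> i \<in> F A \<longleftrightarrow> i \<in> F A'"
    and J_subset: "J \<subseteq> L"
    and J_indep: "\<And>i j j'. i \<in> N \<Longrightarrow> j \<in> J \<Longrightarrow> j' \<in> J \<Longrightarrow> j \<in> D i \<Longrightarrow> j' \<in> D i \<Longrightarrow> j = j'"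
begin

definition block :: "'a \<Rightarrow> 'b set" where
  "block j = {i\<in>N. j \<in> D i}"

text \<open>\<open>Y\<close> is meant to be a seed outside \<open>J\<close>. Testing
  \<open>j\<close> with all other switches off is enough, since they do not affect its
  block.\<close>

definition inert :: "'a set \<Rightarrow> 'a set" where
  "inert Y = {j\<in>J. F (insert j Y) = F Y}"

text \<open>Demanding that one state blanks the block guarantees a nonzero change of weight; a block
  that merely changes could keep its weight.\<close>

definition active :: "'a set \<Rightarrow> 'a set" where
  "active Y = {j\<in>J - inert Y. F (insert j Y) \<inter> block j = {} \<or> F Y \<inter> block j = {}}"

lemma finite_J: "finite J"
  using J_subset finite_L finite_subset by blast

lemma finite_block: "finite (block j)"
  using finite_N by (simp add: block_def)

lemma block_disjoint: "i \<in> J \<Longrightarrow> j \<in> J \<Longrightarrow> i \<noteq> j \<Longrightarrow> block i \<inter> block j = {}"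
  unfolding block_def using J_indep by blast

context
  fixes Y assumes Y: "Y \<subseteq> L - J"
begin

text \<open>An output position in \<open>block j\<close> reads no member of \<open>J\<close> besides
  \<open>j\<close>, so for fixed \<open>Y\<close> only the state of \<open>j\<close> matters to
  it.\<close>

lemma F_block:
  assumes "Z \<subseteq> J" "j \<in> J"
  shows "F (Y \<union> Z) \<inter> block j = (if j \<in> Z then F (insert j Y) else F Y) \<inter> block j"
proof -
  have sub: "Y \<union> Z \<subseteq> L" and sub': "insert j Y \<subseteq> L" using assms Y J_subset by auto
  have "i \<in> F (Y \<union> Z) \<longleftrightarrow> i \<in> (if j \<in> Z then F (insert j Y) else F Y)" if "i \<in> block j" for i
  proof -
    have i: "i \<in> N" "j \<in> D i" using that by (auto simp: block_def)
    have "Z \<inter> D i \<subseteq> {j}" using J_indep[OF i(1)] assms i by blast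
    then have Zi: "Z \<inter> D i = (if j \<in> Z then {j} else {})" using i by auto
    show ?thesis
    proof (cases "j \<in> Z")
      case True
      have "(Y \<union> Z) \<inter> D i = insert j Y \<inter> D i" using Zi True by auto
      then show ?thesis using F_local[OF i(1) sub sub'] True by simp
    next
      case False
      have "(Y \<union> Z) \<inter> D i = Y \<inter> D i" using Zi False by auto
      then show ?thesis using F_local[OF i(1) sub(1), of Y] sub' False by simp
    qed
  qed
  then show ?thesis by auto
qed

lemma F_outside_blocks:
  assumes "Z \<subseteq> J"
  shows "F (Y \<union> Z) - (\<Union>j\<in>J. block j) = F Y - (\<Union>j\<in>J. block j)"
proof -
  have "i \<in> F (Y \<union> Z) \<longleftrightarrow> i \<in> F Y" if "i \<in> N" "i \<notin> (\<Union>j\<in>J. block j)" for i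
  proof -
    have "Z \<inter> D i = {}" using that assms by (auto simp: block_def)
    then show ?thesis using that Y assms J_subset by (intro F_local) auto
  qed
  moreover have "F (Y \<union> Z) \<subseteq> N" "F Y \<subseteq> N" using Y assms J_subset by (auto intro!: F_subset)
  ultimately show ?thesis by blast
qed

lemma F_eqI:
  assumes "Z \<subseteq> J" "Z' \<subseteq> J" "\<And>j. j \<in> J \<Longrightarrow> F (Y \<union> Z) \<inter> block j = F (Y \<union> Z') \<inter> block j"
  shows "F (Y \<union> Z) = F (Y \<union> Z')"
  using F_outside_blocks[OF assms(1)] F_outside_blocks[OF assms(2)] assms(3) by blast

lemma F_minus_inert:
  assumes "Z \<subseteq> J"
  shows "F (Y \<union> Z) = F (Y \<union> (Z - inert Y))"
proof (rule F_eqI)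
  fix j assume "j \<in> J"
  then show "F (Y \<union> Z) \<inter> block j = F (Y \<union> (Z - inert Y)) \<inter> block j"
    using F_block[of Z j] F_block[of "Z - inert Y" j] assms
    by (cases "j \<in> inert Y") (auto simp: inert_def subset_iff)
qed (use assms in auto)

text \<open>Inert switches can be turned off without changing the output, so subsets of
  \<open>J - inert Y\<close> already produce every output of the fibre.\<close>

lemma card_fibre_image: "card ((\<lambda>Z. F (Y \<union> Z)) ` Pow J) \<le> 2 ^ (card J - card (inert Y))"
proof -
  have iJ: "inert Y \<subseteq> J" by (auto simp: inert_def)
  have "(\<lambda>Z. F (Y \<union> Z)) ` Pow J \<subseteq> (\<lambda>Z. F (Y \<union> Z)) ` Pow (J - inert Y)"
  proof
    fix X assume "X \<in> (\<lambda>Z. F (Y \<union> Z)) ` Pow J"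
    then obtain Z where Z: "Z \<subseteq> J" "X = F (Y \<union> Z)" by auto
    then have "X = F (Y \<union> (Z - inert Y))" using F_minus_inert by simp
    then show "X \<in> (\<lambda>Z. F (Y \<union> Z)) ` Pow (J - inert Y)" using Z by auto
  qed
  then have "card ((\<lambda>Z. F (Y \<union> Z)) ` Pow J) \<le> card ((\<lambda>Z. F (Y \<union> Z)) ` Pow (J - inert Y))"
    using finite_J by (intro card_mono) auto
  also have "\<dots> \<le> card (Pow (J - inert Y))"
    using finite_J by (intro card_image_le) auto
  also have "\<dots> = 2 ^ (card J - card (inert Y))"
    using finite_J iJ by (simp add: card_Pow card_Diff_subset finite_subset[OF iJ])
  finally show ?thesis .
qed

text \<open>The weight on a fibre is a constant plus one two-valued term per switch, which is the
  form that \<open>card_majpar_le\<close> needs.\<close>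

lemma card_F:
  assumes "Z \<subseteq> J"
  shows "card (F (Y \<union> Z)) = card (F Y - (\<Union>j\<in>J. block j)) +
    (\<Sum>j\<in>J. if j \<in> Z then card (F (insert j Y) \<inter> block j) else card (F Y \<inter> block j))"
proof -
  have FN: "F (Y \<union> Z) \<subseteq> N" using Y assms J_subset by (auto intro!: F_subset)
  have fin: "finite (F (Y \<union> Z))" using FN finite_N finite_subset by blast
  have "F (Y \<union> Z) = (F (Y \<union> Z) - (\<Union>j\<in>J. block j)) \<union> (\<Union>j\<in>J. F (Y \<union> Z) \<inter> block j)" by auto
  also have "card \<dots> = card (F (Y \<union> Z) - (\<Union>j\<in>J. block j)) + card (\<Union>j\<in>J. F (Y \<union> Z) \<inter> block j)"
    using fin finite_J by (intro card_Un_disjoint) auto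
  also have "card (\<Union>j\<in>J. F (Y \<union> Z) \<inter> block j) = (\<Sum>j\<in>J. card (F (Y \<union> Z) \<inter> block j))"
    using fin finite_J block_disjoint by (intro card_UN_disjoint) (simp_all, blast)
  also have "\<dots> = (\<Sum>j\<in>J. if j \<in> Z then card (F (insert j Y) \<inter> block j) else card (F Y \<inter> block j))"
    using F_block[OF assms] by (intro sum.cong) auto
  finally show ?thesis by (simp add: F_outside_blocks[OF assms])
qed

text \<open>The current state of the switch of an avoided block is one that blanks it, so the switch
  is active unless inert. This ties a quantity visible in the output to the numbers of inert and
  active switches.\<close>

lemma empty_blocks_subset:
  assumes "Z \<subseteq> J"
  shows "{j\<in>J. F (Y \<union> Z) \<inter> block j = {}} \<subseteq> inert Y \<union> active Y"
proof
  fix j assume "j \<in> {j\<in>J. F (Y \<union> Z) \<inter> block j = {}}"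
  then show "j \<in> inert Y \<union> active Y"
    using F_block[OF assms, of j] by (simp add: active_def split: if_splits)
qed

text \<open>Switch \<open>j\<close> influences nothing outside \<open>block j\<close>, so an
  unchanged block would mean an unchanged output and make \<open>j\<close> inert.\<close>

lemma active_block_ne:
  assumes "j \<in> active Y"
  shows "F (insert j Y) \<inter> block j \<noteq> F Y \<inter> block j"
proof
  assume eq: "F (insert j Y) \<inter> block j = F Y \<inter> block j"
  have j: "j \<in> J" using assms by (auto simp: active_def)
  have "F (Y \<union> {j}) = F (Y \<union> {})"
  proof (rule F_eqI)
    fix i assume "i \<in> J"
    then show "F (Y \<union> {j}) \<inter> block i = F (Y \<union> {}) \<inter> block i"
      using j eq F_block[of "{j}" i] F_block[of "{}" i] by (cases "i = j") simp_all
  qed (use j in auto)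
  then have "j \<in> inert Y" using j by (simp add: inert_def)
  then show False using assms by (simp add: active_def)
qed

text \<open>Exactly one of the two counts is zero, so the difference is nonzero and of absolute
  value below the prime \<open>p\<close>.\<close>

lemma active_coprime:
  assumes "j \<in> active Y" "prime p" "card (block j) < p"
  shows "coprime (int (card (F (insert j Y) \<inter> block j)) - int (card (F Y \<inter> block j))) (int p)"
proof -
  let ?a = "card (F (insert j Y) \<inter> block j)" and ?b = "card (F Y \<inter> block j)"
  have le: "?a \<le> card (block j)" "?b \<le> card (block j)"
    using finite_block by (auto intro!: card_mono)
  have "?a = 0 \<and> ?b \<noteq> 0 \<or> ?a \<noteq> 0 \<and> ?b = 0"
  proof -
    have "finite (F (insert j Y) \<inter> block j)" "finite (F Y \<inter> block j)" using finite_block by auto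
    moreover have "F (insert j Y) \<inter> block j = {} \<or> F Y \<inter> block j = {}"
      using assms(1) by (simp add: active_def)
    ultimately show ?thesis using active_block_ne[OF assms(1)] by (metis card_0_eq)
  qed
  then have "\<bar>int ?a - int ?b\<bar> < int p" "int ?a - int ?b \<noteq> 0" using le assms(3) by auto
  then have "\<not> int p dvd int ?a - int ?b" using dvd_imp_le_int[of "int ?a - int ?b" "int p"] by linarith
  moreover have "prime (int p)" using assms(2) by simp
  ultimately show ?thesis by (metis coprime_commute prime_imp_coprime)
qed

end

end

section \<open>The distinguishing test\<close>

context fibred_map
begin

text \<open>Here \<open>g\<close> is the sampled last bit, constant on fibres. A fibre has many
  inert switches from \<open>\<kappa>\<close> on and many active ones from \<open>t\<close> on; with
  fewer of both, its outputs avoid fewer than \<open>q * card J / 4\<close> blocks, which is rare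
  for a uniform set.\<close>

lemma distinguishing_test:
  fixes g :: "'a set \<Rightarrow> bool" and p :: nat and q \<kappa> t :: real
  assumes g: "\<And>Y Z. Y \<subseteq> L - J \<Longrightarrow> Z \<subseteq> J \<Longrightarrow> g (Y \<union> Z) = g Y"
    and p: "prime p" "odd p"
    and small: "\<And>j. j \<in> J \<Longrightarrow> card (block j) < p"
    and q: "\<And>j. j \<in> J \<Longrightarrow> q \<le> (1/2) ^ card (block j)" "0 \<le> q" "q \<le> 1"
    and t: "t + \<kappa> \<le> q * card J / 4"
  obtains T :: "('b set \<times> bool) set" where
    "2 ^ card L * (1 / 2 - 1 / (2 * p) - 2 * p * exp (- t / (16 * p\<^sup>2))) \<le> real (card {A\<in>Pow L. (F A, g A) \<in> T})"
    "real (card {X\<in>Pow N. (X, majpar p (card X)) \<in> T}) \<le> 2 powr (card L - \<kappa>) + 2 ^ card N * exp (- q * card J / 4)"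
proof -
  define e where "e = 1 / (2 * p) + 2 * p * exp (- t / (16 * p\<^sup>2))"
  define Inert where "Inert = {Y\<in>Pow (L - J). \<kappa> \<le> card (inert Y)}"
  define TF where "TF = (\<Union>Y\<in>Inert. (\<lambda>Z. F (Y \<union> Z)) ` Pow J)"
  define few where "few X \<longleftrightarrow> real (card {j\<in>J. X \<inter> block j = {}}) < q * card J / 4" for X
  \<comment> \<open>The test accepts outputs of seeds with many inert switches, outputs that avoid
    too few blocks, and wrong last bits.\<close>
  define T where "T = {(X, v). X \<in> TF \<or> few X \<or> v \<noteq> majpar p (card X)}"
  have cL: "card L = card (L - J) + card J"
    using finite_L finite_J J_subset by (metis card_Diff_subset card_mono le_add_diff_inverse2)
  have fInert: "finite Inert" using finite_L by (simp add: Inert_def)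
  have p0: "p > 0" using p(1) prime_gt_0_nat by simp

  \<comment> \<open>A correct pair has no wrong last bit, so it can be accepted only for one of the
    first two reasons.\<close>
  have "real (card {X\<in>Pow N. (X, majpar p (card X)) \<in> T}) \<le> real (card (TF \<union> {X\<in>Pow N. few X}))"
    using fInert finite_J finite_N by (intro of_nat_mono card_mono) (auto simp: T_def TF_def)
  also have "\<dots> \<le> real (card TF) + real (card {X\<in>Pow N. few X})"
    using card_Un_le[of TF "{X\<in>Pow N. few X}"] by linarith
  also have "real (card {X\<in>Pow N. few X}) \<le> 2 ^ card N * exp (- q * card J / 4)"
    unfolding few_def
    by (rule card_few_avoided_blocks)
       (use finite_J finite_N block_disjoint q in \<open>auto simp: block_def\<close>)
  \<comment> \<open>There are at most \<open>2 ^ card (L - J)\<close> such seeds \<open>Y\<close>,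
    each with at most \<open>2 powr (card J - \<kappa>)\<close> outputs.\<close>
  also have "real (card TF) \<le> 2 powr (card L - \<kappa>)"
  proof -
    have "card TF \<le> (\<Sum>Y\<in>Inert. card ((\<lambda>Z. F (Y \<union> Z)) ` Pow J))"
      unfolding TF_def using fInert by (rule card_UN_le)
    then have "real (card TF) \<le> (\<Sum>Y\<in>Inert. real (card ((\<lambda>Z. F (Y \<union> Z)) ` Pow J)))"
      by (metis of_nat_le_iff of_nat_sum)
    also have "\<dots> \<le> (\<Sum>Y\<in>Inert. 2 powr (card J - \<kappa>))"
    proof (intro sum_mono)
      fix Y assume Y: "Y \<in> Inert"
      have "inert Y \<subseteq> J" by (auto simp: inert_def)
      then have le: "card (inert Y) \<le> card J" using finite_J by (rule card_mono[rotated])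
      have "real (card ((\<lambda>Z. F (Y \<union> Z)) ` Pow J)) \<le> real (2 ^ (card J - card (inert Y)))"
        using Y card_fibre_image[of Y] by (intro of_nat_mono) (auto simp: Inert_def)
      also have "\<dots> = 2 powr (real (card J) - card (inert Y))"
        using le by (simp add: powr_realpow[symmetric] of_nat_diff)
      also have "\<dots> \<le> 2 powr (card J - \<kappa>)" using Y by (simp add: Inert_def)
      finally show "real (card ((\<lambda>Z. F (Y \<union> Z)) ` Pow J)) \<le> 2 powr (card J - \<kappa>)" .
    qed
    also have "\<dots> = real (card Inert) * 2 powr (card J - \<kappa>)" by simp
    also have "\<dots> \<le> 2 powr card (L - J) * 2 powr (card J - \<kappa>)"
    proof (intro mult_right_mono)
      have "card Inert \<le> card (Pow (L - J))"
        using finite_L by (intro card_mono) (auto simp: Inert_def)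
      then have "real (card Inert) \<le> real (2 ^ card (L - J))"
        using finite_L by (simp add: card_Pow)
      then show "real (card Inert) \<le> 2 powr card (L - J)" by (simp add: powr_realpow)
    qed simp
    also have "\<dots> = 2 powr (card L - \<kappa>)" by (simp add: powr_add[symmetric] cL add_diff_eq)
    finally show ?thesis .
  qed
  finally have 2: "real (card {X\<in>Pow N. (X, majpar p (card X)) \<in> T})
      \<le> 2 powr (card L - \<kappa>) + 2 ^ card N * exp (- q * card J / 4)" by simp

  have fibre: "2 ^ card J * (1 / 2 - e) \<le> real (card {Z\<in>Pow J. (F (Y \<union> Z), g (Y \<union> Z)) \<in> T})"
    if "Y \<in> Pow (L - J)" for Y
  proof (cases "\<kappa> \<le> card (inert Y) \<or> card (active Y) < t")
    case True
    \<comment> \<open>The whole fibre is accepted here: its outputs lie in \<open>TF\<close> or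
      avoid too few blocks.\<close>
    have "(F (Y \<union> Z), g (Y \<union> Z)) \<in> T" if Z: "Z \<subseteq> J" for Z
    proof (cases "\<kappa> \<le> card (inert Y)")
      case True
      then have "F (Y \<union> Z) \<in> TF" using Z \<open>Y \<in> Pow (L - J)\<close> by (auto simp: TF_def Inert_def)
      then show ?thesis by (simp add: T_def)
    next
      case False
      have fin: "finite (inert Y \<union> active Y)"
        using finite_J by (simp add: inert_def active_def)
      have "card {j\<in>J. F (Y \<union> Z) \<inter> block j = {}} \<le> card (inert Y \<union> active Y)"
        using \<open>Y \<in> Pow (L - J)\<close> Z by (intro card_mono fin empty_blocks_subset) auto
      also have "\<dots> \<le> card (inert Y) + card (active Y)" by (rule card_Un_le)
      finally have "few (F (Y \<union> Z))" using False True t unfolding few_def by linarith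
      then show ?thesis by (simp add: T_def)
    qed
    then have "{Z\<in>Pow J. (F (Y \<union> Z), g (Y \<union> Z)) \<in> T} = Pow J" by auto
    then have "real (card {Z\<in>Pow J. (F (Y \<union> Z), g (Y \<union> Z)) \<in> T}) = 2 ^ card J * 1"
      using finite_J by (simp add: card_Pow)
    moreover have "e \<ge> 0" by (simp add: e_def)
    then have "2 ^ card J * (1 / 2 - e) \<le> 2 ^ card J * (1::real)" by (intro mult_left_mono) auto
    ultimately show ?thesis by linarith
  next
    case False
    have Y: "Y \<subseteq> L - J" using that by auto
    let ?a = "\<lambda>j. card (F (insert j Y) \<inter> block j)" and ?b = "\<lambda>j. card (F Y \<inter> block j)"
    let ?c = "card (F Y - (\<Union>j\<in>J. block j))"
    let ?M = "{Z\<in>Pow J. majpar p (?c + (\<Sum>j\<in>J. if j \<in> Z then ?a j else ?b j)) = g Y}"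
    have sub: "active Y \<subseteq> J" by (auto simp: active_def)
    have "real (card ?M)
        \<le> 2 ^ card J * (1 / 2 + 1 / (2 * p) + 2 * p * exp (- real (card (active Y)) / (16 * p\<^sup>2)))"
    proof (rule card_majpar_le[OF finite_J p(2) sub])
      fix j assume "j \<in> active Y"
      then show "coprime (int (?a j) - int (?b j)) (int p)"
        using active_coprime[OF Y _ p(1)] small sub by blast
    qed
    also have "\<dots> \<le> 2 ^ card J * (1 / 2 + e)"
    proof -
      have "exp (- real (card (active Y)) / (16 * p\<^sup>2)) \<le> exp (- t / (16 * p\<^sup>2))"
        using False p0 by (simp add: divide_right_mono)
      then show ?thesis unfolding e_def by (simp add: mult_left_mono)
    qed
    finally have M: "real (card ?M) \<le> 2 ^ card J * (1 / 2 + e)" .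
    \<comment> \<open>A rejected \<open>Z\<close> has the correct last bit, so the constant guess
      \<open>g Y\<close> equals \<open>majpar\<close> of the weight and \<open>Z\<close> lies in
      \<open>?M\<close>, which is little more than half of the fibre.\<close>
    have "Pow J \<subseteq> {Z\<in>Pow J. (F (Y \<union> Z), g (Y \<union> Z)) \<in> T} \<union> ?M"
    proof
      fix Z assume "Z \<in> Pow J"
      then have Z: "Z \<subseteq> J" by simp
      show "Z \<in> {Z\<in>Pow J. (F (Y \<union> Z), g (Y \<union> Z)) \<in> T} \<union> ?M"
        using card_F[OF Y Z] g[OF Y Z] Z by (auto simp: T_def)
    qed
    then have "card (Pow J) \<le> card ({Z\<in>Pow J. (F (Y \<union> Z), g (Y \<union> Z)) \<in> T} \<union> ?M)"
      using finite_J by (intro card_mono) auto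
    also have "\<dots> \<le> card {Z\<in>Pow J. (F (Y \<union> Z), g (Y \<union> Z)) \<in> T} + card ?M" by (rule card_Un_le)
    finally have "real (card (Pow J)) \<le> real (card {Z\<in>Pow J. (F (Y \<union> Z), g (Y \<union> Z)) \<in> T}) + real (card ?M)"
      by (simp only: of_nat_add[symmetric] of_nat_le_iff)
    moreover have "real (card (Pow J)) = 2 ^ card J" using finite_J by (simp add: card_Pow)
    ultimately show ?thesis using M by (simp add: algebra_simps)
  qed
  have "2 ^ card L * (1 / 2 - e) = (\<Sum>Y\<in>Pow (L - J). 2 ^ card J * (1 / 2 - e))"
    using finite_L by (simp add: card_Pow cL power_add)
  also have "\<dots> \<le> (\<Sum>Y\<in>Pow (L - J). real (card {Z\<in>Pow J. (F (Y \<union> Z), g (Y \<union> Z)) \<in> T}))"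
    by (intro sum_mono fibre)
  also have "\<dots> = real (card {A\<in>Pow ((L - J) \<union> J). (F A, g A) \<in> T})"
    using finite_L finite_J by (intro card_Pow_Un[symmetric]) auto
  also have "(L - J) \<union> J = L" using J_subset by auto
  finally show thesis using 2 by (intro that[of T]) (simp_all add: e_def diff_diff_eq)
qed

end

section \<open>Choice of independent seed bits\<close>

text \<open>Double counting the pairs of an output and a seed position read by it shows that at most
  \<open>card N / 4\<close> positions are read by more than \<open>4 * d\<close> outputs. These and
  \<open>E\<close> are removed. Among the rest, positions read by a common output are joined;
  degrees are at most \<open>4 * d * d\<close>, so a large independent set exists.\<close>

lemma independent_inputs_exist:
  fixes D :: "'b \<Rightarrow> 'a set" and d :: real
  assumes L: "finite L" and N: "finite N" and D: "\<And>i. i \<in> N \<Longrightarrow> D i \<subseteq> L \<and> card (D i) \<le> d"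
    and E: "finite E" "card E \<le> d" and d: "d > 0" and NL: "card N \<le> card L"
  obtains J where "J \<subseteq> L - E" "\<And>i j j'. i \<in> N \<Longrightarrow> j \<in> J \<Longrightarrow> j' \<in> J \<Longrightarrow> j \<in> D i \<Longrightarrow> j' \<in> D i \<Longrightarrow> j = j'"
    "\<And>j. j \<in> J \<Longrightarrow> card {i\<in>N. j \<in> D i} \<le> 4 * d"
    "3 / 4 * real (card N) - d \<le> card J * (4 * d\<^sup>2 + 1)"
proof -
  define deg where "deg j = card {i\<in>N. j \<in> D i}" for j
  define bad where "bad = {j\<in>L. real (deg j) > 4 * d}"
  define V where "V = L - bad - E"
  define R where "R j j' \<longleftrightarrow> (\<exists>i\<in>N. j \<in> D i \<and> j' \<in> D i)" for j j'
  have fV: "finite V" "finite bad" using L by (auto simp: V_def bad_def)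
  have "real (card bad) * (4 * d) = (\<Sum>j\<in>bad. 4 * d)" by simp
  also have "\<dots> \<le> (\<Sum>j\<in>bad. real (deg j))" by (intro sum_mono) (auto simp: bad_def)
  also have "\<dots> \<le> (\<Sum>j\<in>L. real (deg j))" using L by (intro sum_mono2) (auto simp: bad_def)
  also have "\<dots> = (\<Sum>j\<in>L. \<Sum>i\<in>N. if j \<in> D i then 1 else 0)"
    unfolding deg_def using N by (simp add: card_Collect_eq_sum)
  also have "\<dots> = (\<Sum>i\<in>N. \<Sum>j\<in>L. if j \<in> D i then 1 else 0)" by (rule sum.swap)
  also have "\<dots> = (\<Sum>i\<in>N. real (card {j\<in>L. j \<in> D i}))"
    using L by (simp add: card_Collect_eq_sum)
  also have "\<dots> \<le> (\<Sum>i\<in>N. d)"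
  proof (intro sum_mono)
    fix i assume "i \<in> N"
    then have "{j\<in>L. j \<in> D i} = D i" "card (D i) \<le> d" using D by auto
    then show "real (card {j\<in>L. j \<in> D i}) \<le> d" by simp
  qed
  finally have "real (card bad) * 4 * d \<le> real (card N) * d" by simp
  then have bad: "real (card bad) \<le> real (card N) / 4" using d by (simp add: field_simps)
  have "card L \<le> card V + card bad + card E"
  proof -
    have "L \<subseteq> V \<union> bad \<union> E" by (auto simp: V_def)
    then have "card L \<le> card (V \<union> bad \<union> E)" using fV E by (intro card_mono) auto
    also have "\<dots> \<le> card V + card bad + card E"
      using card_Un_le[of "V \<union> bad" E] card_Un_le[of V bad] by linarith
    finally show ?thesis .
  qed
  then have V: "3 / 4 * real (card N) - d \<le> card V" using bad NL E by linarith
  have "real (card {w\<in>V. R v w}) \<le> 4 * d\<^sup>2" if v: "v \<in> V" for v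
  proof -
    let ?B = "{i\<in>N. v \<in> D i}"
    have "{w\<in>V. R v w} \<subseteq> (\<Union>i\<in>?B. D i)" by (auto simp: R_def)
    then have "card {w\<in>V. R v w} \<le> card (\<Union>i\<in>?B. D i)"
      using N D L by (intro card_mono) (auto intro: finite_subset)
    also have "\<dots> \<le> (\<Sum>i\<in>?B. card (D i))" using N by (intro card_UN_le) auto
    finally have "real (card {w\<in>V. R v w}) \<le> (\<Sum>i\<in>?B. real (card (D i)))"
      by (metis of_nat_le_iff of_nat_sum)
    also have "\<dots> \<le> (\<Sum>i\<in>?B. d)" using D by (intro sum_mono) auto
    also have "\<dots> = deg v * d" by (simp add: deg_def)
    also have "\<dots> \<le> (4 * d) * d" using v d by (intro mult_right_mono) (auto simp: V_def bad_def)
    finally show ?thesis by (simp add: power2_eq_square)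
  qed
  moreover have "symp R" by (auto simp: R_def symp_def)
  ultimately obtain J where J: "J \<subseteq> V" "\<And>i j. i \<in> J \<Longrightarrow> j \<in> J \<Longrightarrow> i \<noteq> j \<Longrightarrow> \<not> R i j"
    "real (card V) \<le> real (card J) * (4 * d\<^sup>2 + 1)"
    using independent_set_exists[OF fV(1)] by blast
  show thesis
  proof (rule that[of J])
    show "J \<subseteq> L - E" using J by (auto simp: V_def)
    show "j = j'" if "i \<in> N" "j \<in> J" "j' \<in> J" "j \<in> D i" "j' \<in> D i" for i j j'
      using J(2)[of j j'] that by (auto simp: R_def)
    show "card {i\<in>N. j \<in> D i} \<le> 4 * d" if "j \<in> J" for j
    proof -
      have "j \<in> L" "j \<notin> bad" using that J(1) by (auto simp: V_def)
      then show ?thesis by (simp add: bad_def deg_def)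
    qed
    show "3 / 4 * real (card N) - d \<le> card J * (4 * d\<^sup>2 + 1)" using J(3) V by linarith
  qed
qed

section \<open>Bit strings as sets, and total variation distance\<close>

definition bits :: "nat \<Rightarrow> nat set \<Rightarrow> bool list" where
  "bits k A = map (\<lambda>i. i \<in> A) [0..<k]"

lemma length_bits [simp]: "length (bits k A) = k"
  by (simp add: bits_def)

lemma nth_bits [simp]: "i < k \<Longrightarrow> bits k A ! i \<longleftrightarrow> i \<in> A"
  by (simp add: bits_def)

lemma bij_betw_bits: "bij_betw (bits k) (Pow {..<k}) (bitstrings k)"
  by (rule bij_betw_byWitness[where f' = "\<lambda>x. {i. i < k \<and> x ! i}"])
     (auto simp: bitstrings_def intro!: nth_equalityI)

lemma hweight_bits:
  assumes "A \<subseteq> {..<k}"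
  shows "hweight (bits k A) = card A"
proof -
  have "hweight (bits k A) = length (filter (\<lambda>i. i \<in> A) [0..<k])"
    by (simp add: hweight_def bits_def filter_map o_def)
  also have "\<dots> = card (set (filter (\<lambda>i. i \<in> A) [0..<k]))"
    by (rule distinct_card[symmetric]) simp
  also have "set (filter (\<lambda>i. i \<in> A) [0..<k]) = A" using assms by auto
  finally show ?thesis .
qed

lemma majmod_parity_bits:
  assumes "A \<subseteq> {..<k}"
  shows "(majmod p (bits k A) \<noteq> parity (bits k A)) = majpar p (card A)"
  by (simp add: majmod_def parity_def majpar_def hweight_bits[OF assms])

lemma prob_map_uniform_bits:
  "measure_pmf.prob (map_pmf h (uniform_bits k)) T = card {A\<in>Pow {..<k}. h (bits k A) \<in> T} / 2 ^ k"
proof -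
  have B: "bitstrings k = bits k ` Pow {..<k}" and inj: "inj_on (bits k) (Pow {..<k})"
    using bij_betw_bits[of k] by (auto simp: bij_betw_def)
  have bitstrings_finite: "finite (bitstrings k)" and bitstrings_nonempty: "bitstrings k \<noteq> {}"
    unfolding B by auto
  have "card (bitstrings k) = 2 ^ k" using inj by (simp add: B card_image card_Pow)
  moreover have "card (bitstrings k \<inter> h -` T) = card {A\<in>Pow {..<k}. h (bits k A) \<in> T}"
  proof -
    have "bitstrings k \<inter> h -` T = bits k ` {A\<in>Pow {..<k}. h (bits k A) \<in> T}" by (auto simp: B)
    then show ?thesis by (simp only:) (rule card_image, rule inj_on_subset[OF inj], auto)
  qed
  ultimately show ?thesis
    by (simp add: uniform_bits_def measure_pmf_of_set bitstrings_nonempty bitstrings_finite)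
qed

lemma tv_dist_ge: "measure_pmf.prob D1 T - measure_pmf.prob D2 T \<le> tv_dist D1 D2"
proof -
  have "\<bar>measure_pmf.prob D1 T - measure_pmf.prob D2 T\<bar> \<le> tv_dist D1 D2"
    unfolding tv_dist_def
  proof (rule cSUP_upper)
    have "\<bar>measure_pmf.prob D1 T - measure_pmf.prob D2 T\<bar> \<le> 1" for T
      using measure_pmf.prob_le_1[of D1 T] measure_pmf.prob_le_1[of D2 T]
        measure_nonneg[of "measure_pmf D1" T] measure_nonneg[of "measure_pmf D2" T] by linarith
    then show "bdd_above (range (\<lambda>T. \<bar>measure_pmf.prob D1 T - measure_pmf.prob D2 T\<bar>))"
      by (intro bdd_aboveI[of _ 1]) auto
  qed simp
  then show ?thesis by linarith
qed

text \<open>A test on pairs of a set and a bit pulls back to strings: the first \<open>n\<close>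
  positions give the set, and position \<open>n\<close>, counted from zero, gives the last
  bit.\<close>

lemma tv_dist_majpar_ge:
  fixes T :: "(nat set \<times> bool) set"
  defines "F \<equiv> \<lambda>l n f A. {i. i < n \<and> f (bits l A) ! i}"
  shows "card {A\<in>Pow {..<l}. (F l n f A, f (bits l A) ! n) \<in> T} / 2 ^ l
      - card {X\<in>Pow {..<n}. (X, majpar p (card X)) \<in> T} / 2 ^ n
    \<le> tv_dist (map_pmf f (uniform_bits l))
        (map_pmf (\<lambda>x. x @ [majmod p x \<noteq> parity x]) (uniform_bits n))"
proof -
  let ?T = "{z. ({i. i < n \<and> z ! i}, z ! n) \<in> T}"
  have "{i. i < n \<and> (bits n X @ [b]) ! i} = X" if "X \<subseteq> {..<n}" for X b
    using that by (auto simp: nth_append)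
  moreover have "(bits n X @ [b]) ! n = b" for X b by (simp add: nth_append)
  ultimately have "{X\<in>Pow {..<n}. bits n X @ [majmod p (bits n X) \<noteq> parity (bits n X)] \<in> ?T}
      = {X\<in>Pow {..<n}. (X, majpar p (card X)) \<in> T}"
    by (intro Collect_cong conj_cong refl) (simp only: mem_Collect_eq Pow_iff majmod_parity_bits)
  then show ?thesis
    using tv_dist_ge[of "map_pmf f (uniform_bits l)" ?T
        "map_pmf (\<lambda>x. x @ [majmod p x \<noteq> parity x]) (uniform_bits n)"]
    by (simp only: prob_map_uniform_bits) (simp add: F_def)
qed

text \<open>The test is the support of the sampler. It has at most \<open>2 ^ l\<close> strings,
  while the target is uniform on \<open>2 ^ n\<close> distinct ones.\<close>

lemma tv_dist_short_seed:
  assumes "l < n"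
  shows "1 / 2 \<le> tv_dist (map_pmf f (uniform_bits l)) (map_pmf (\<lambda>x. x @ [b x]) (uniform_bits n))"
proof -
  let ?T = "(\<lambda>A. f (bits l A)) ` Pow {..<l}"
  let ?h = "\<lambda>X. bits n X @ [b (bits n X)]"
  have "{A\<in>Pow {..<l}. f (bits l A) \<in> ?T} = Pow {..<l}" by auto
  then have 1: "measure_pmf.prob (map_pmf f (uniform_bits l)) ?T = 1"
    by (simp only: prob_map_uniform_bits) (simp add: card_Pow)
  have inj: "inj_on ?h (Pow {..<n})"
    using bij_betw_bits[of n] by (auto simp: bij_betw_def inj_on_def)
  have "card {X\<in>Pow {..<n}. ?h X \<in> ?T} = card (?h ` {X\<in>Pow {..<n}. ?h X \<in> ?T})"
    by (rule card_image[symmetric]) (rule inj_on_subset[OF inj], auto)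
  also have "\<dots> \<le> card ?T" by (intro card_mono) auto
  also have "\<dots> \<le> card (Pow {..<l})" by (intro card_image_le) simp
  also have "\<dots> = 2 ^ l" by (simp add: card_Pow)
  finally have "real (card {X\<in>Pow {..<n}. ?h X \<in> ?T}) \<le> real (2 ^ l)"
    by (rule of_nat_mono)
  also have "\<dots> \<le> 2 ^ n / 2"
  proof -
    have "(2::real) ^ Suc l \<le> 2 ^ n" using assms by (intro power_increasing) auto
    then show ?thesis by simp
  qed
  finally have "measure_pmf.prob (map_pmf (\<lambda>x. x @ [b x]) (uniform_bits n)) ?T \<le> 1 / 2"
    unfolding prob_map_uniform_bits by (simp add: field_simps)
  then show ?thesis
    using tv_dist_ge[of "map_pmf f (uniform_bits l)" ?T "map_pmf (\<lambda>x. x @ [b x]) (uniform_bits n)"] 1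
    by linarith
qed

section \<open>Local samplers with at least \<open>n\<close> seed bits\<close>

text \<open>\<open>q\<close> bounds from below the probability that a uniform string vanishes on a
  block of at most \<open>4 * d\<close> positions, and \<open>s\<close> bounds from below the number
  of switches found by \<open>independent_inputs_exist\<close>.\<close>

lemma tv_dist_local_ge:
  fixes d \<kappa> t :: real and n l p :: nat
  defines "q \<equiv> 2 powr (- 4 * d)" and "s \<equiv> (3 / 4 * real n - d) / (4 * d\<^sup>2 + 1)"
  assumes loc: "is_local d l (n + 1) f" and nl: "n \<le> l" and p: "prime p" "odd p"
    and d: "0 < d" "4 * d < p" and t: "t + \<kappa> \<le> q * s / 4"
  shows "1 / 2 - 1 / (2 * p) - 2 * p * exp (- t / (16 * p\<^sup>2)) - 2 powr (real l - n - \<kappa>) - exp (- q * s / 4)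
    \<le> tv_dist (map_pmf f (uniform_bits l))
        (map_pmf (\<lambda>x. x @ [majmod p x \<noteq> parity x]) (uniform_bits n))"
proof -
  have "\<forall>i\<in>{..<n + 1}. \<exists>S. S \<subseteq> {..<l} \<and> real (card S) \<le> d \<and>
        (\<forall>x \<in> bitstrings l. \<forall>y \<in> bitstrings l. (\<forall>j \<in> S. x ! j = y ! j) \<longrightarrow> f x ! i = f y ! i)"
    using loc by (simp add: is_local_def)
  then obtain S where S: "\<forall>i\<in>{..<n + 1}. S i \<subseteq> {..<l} \<and> real (card (S i)) \<le> d \<and>
        (\<forall>x \<in> bitstrings l. \<forall>y \<in> bitstrings l. (\<forall>j \<in> S i. x ! j = y ! j) \<longrightarrow> f x ! i = f y ! i)"
    by (rule bchoice[THEN exE])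
  have S_dep: "f (bits l A) ! i = f (bits l A') ! i" if "i < n + 1" "A \<inter> S i = A' \<inter> S i" for i A A'
  proof -
    have "bits l A ! j = bits l A' ! j" if "j \<in> S i" for j
    proof -
      have "j < l" using S \<open>i < n + 1\<close> that by auto
      then show ?thesis using that \<open>A \<inter> S i = A' \<inter> S i\<close> by auto
    qed
    moreover have "bits l A \<in> bitstrings l" "bits l A' \<in> bitstrings l"
      by (auto simp: bitstrings_def)
    ultimately show ?thesis using S \<open>i < n + 1\<close> by blast
  qed
  have fin: "finite (S n)" using S finite_subset[of "S n" "{..<l}"] by auto
  \<comment> \<open>Excluding \<open>S n\<close>, the positions read by the last output bit, makes
    that bit constant on fibres.\<close>
  obtain J where J: "J \<subseteq> {..<l} - S n"
    and indep: "\<And>i j j'. i \<in> {..<n} \<Longrightarrow> j \<in> J \<Longrightarrow> j' \<in> J \<Longrightarrow> j \<in> S i \<Longrightarrow> j' \<in> S i \<Longrightarrow> j = j'"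
    and deg: "\<And>j. j \<in> J \<Longrightarrow> card {i\<in>{..<n}. j \<in> S i} \<le> 4 * d"
    and cJ: "3 / 4 * real (card {..<n}) - d \<le> card J * (4 * d\<^sup>2 + 1)"
    using independent_inputs_exist[of "{..<l}" "{..<n}" S d "S n"] S fin d(1) nl by auto
  have "0 < 4 * d\<^sup>2 + 1" by (simp add: add_nonneg_pos)
  then have sJ: "s \<le> card J" using cJ by (simp add: s_def pos_divide_le_eq)
  define F where "F A = {i. i < n \<and> f (bits l A) ! i}" for A
  interpret fibred_map "{..<l}" "{..<n}" F S J
  proof unfold_locales
    fix i A A' assume "i \<in> {..<n}" "A \<inter> S i = A' \<inter> S i"
    then show "i \<in> F A \<longleftrightarrow> i \<in> F A'" using S_dep[of i A A'] by (simp add: F_def)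
  next
    show "J \<subseteq> {..<l}" using J by auto
  next
    fix i j j' assume "i \<in> {..<n}" "j \<in> J" "j' \<in> J" "j \<in> S i" "j' \<in> S i"
    then show "j = j'" by (rule indep)
  qed (auto simp: F_def)
  have q: "0 \<le> q" "q \<le> 1" using d powr_mono[of "- 4 * d" 0 2] by (auto simp: q_def)
  have qs: "q * s \<le> q * card J" using sJ q by (intro mult_left_mono)
  have blk: "card (block j) \<le> 4 * d" if "j \<in> J" for j
    using deg[OF that] by (simp add: block_def)
  have "q \<le> (1 / 2) ^ card (block j)" if "j \<in> J" for j
  proof -
    have "q \<le> 2 powr (- real (card (block j)))" using blk[OF that] by (simp add: q_def)
    also have "\<dots> = (1 / 2) ^ card (block j)"
      by (simp add: powr_minus powr_realpow power_one_over inverse_eq_divide)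
    finally show ?thesis .
  qed
  moreover have "card (block j) < p" if "j \<in> J" for j using blk[OF that] d(2) by linarith
  moreover have "f (bits l (Y \<union> Z)) ! n = f (bits l Y) ! n" if "Z \<subseteq> J" for Y Z
    using that J by (intro S_dep) auto
  moreover have "t + \<kappa> \<le> q * card J / 4" using t qs by linarith
  ultimately obtain T where
    T1: "2 ^ card {..<l} * (1 / 2 - 1 / (2 * p) - 2 * p * exp (- t / (16 * p\<^sup>2)))
      \<le> real (card {A\<in>Pow {..<l}. (F A, f (bits l A) ! n) \<in> T})" and
    T2: "real (card {X\<in>Pow {..<n}. (X, majpar p (card X)) \<in> T})
      \<le> 2 powr (card {..<l} - \<kappa>) + 2 ^ card {..<n} * exp (- q * card J / 4)"
    using distinguishing_test[where g="\<lambda>A. f (bits l A) ! n" and p=p and q=q and \<kappa>=\<kappa> and t=t] p q by blast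
  have "1 / 2 - 1 / (2 * p) - 2 * p * exp (- t / (16 * p\<^sup>2))
      \<le> card {A\<in>Pow {..<l}. (F A, f (bits l A) ! n) \<in> T} / 2 ^ l"
    using T1 by (simp add: pos_le_divide_eq mult.commute)
  moreover have "card {X\<in>Pow {..<n}. (X, majpar p (card X)) \<in> T} / 2 ^ n
      \<le> 2 powr (real l - n - \<kappa>) + exp (- q * s / 4)"
  proof -
    have "exp (- q * card J / 4) \<le> exp (- q * s / 4)" using qs by simp
    then have "2 powr (card {..<l} - \<kappa>) + 2 ^ card {..<n} * exp (- q * card J / 4)
        \<le> 2 ^ n * (2 powr (real l - n - \<kappa>) + exp (- q * s / 4))"
      by (simp add: distrib_left powr_realpow[symmetric] powr_add[symmetric])
    then show ?thesis using T2 by (simp add: pos_divide_le_eq mult.commute)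
  qed
  ultimately show ?thesis
    using tv_dist_majpar_ge[of l n f T p] unfolding F_def by linarith
qed

section \<open>Asymptotic choice of the parameters\<close>

theorem theorem5p1:
  fixes \<delta> \<alpha> :: real
  assumes "0 \<le> \<delta>" "\<delta> < 1" "\<delta> / 3 < \<alpha>" "\<alpha> < 1 / 3"
  shows "\<exists>\<epsilon>>0. \<forall>c1 c2 :: real. 0 < c1 \<and> c1 \<le> c2 \<longrightarrow>
          (\<exists>C>0. \<exists>n0::nat. \<forall>n \<ge> n0. \<forall>p::nat. \<forall>l::nat. \<forall>f.
             prime p \<and> c1 * real n powr \<alpha> \<le> real p \<and> real p \<le> c2 * real n powr \<alpha> \<and>
             real l \<le> real n + real n powr \<delta> \<and>
             is_local (\<epsilon> * log 2 (real n)) l (n + 1) f \<longrightarrow>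
             tv_dist (map_pmf f (uniform_bits l))
                     (map_pmf (\<lambda>x. x @ [majmod p x \<noteq> parity x]) (uniform_bits n))
               \<ge> 1 / 2 - C / log 2 (real n))"
proof -
  \<comment> \<open>The exponent \<open>M\<close> is below 1, at least \<open>\<delta>\<close> to
    cover the seed surplus, and at least \<open>2 / 3\<close>, which exceeds
    \<open>2 * \<alpha>\<close>. As \<open>1 - 4 * \<epsilon>\<close> equals
    \<open>(1 + M) / 2\<close>, the exponent \<open>\<gamma>\<close> lies strictly between
    \<open>M\<close> and it; \<open>n powr \<gamma>\<close> serves as the threshold \<open>t\<close>
    and outgrows the square of \<open>p\<close>.\<close>
  define M where "M = max \<delta> (2 / 3)"
  define \<epsilon> where "\<epsilon> = (1 - M) / 8"
  define \<gamma> where "\<gamma> = (1 + 3 * M) / 4"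
  have M: "\<delta> \<le> M" "2 / 3 \<le> M" "M < 1" using assms(2) by (auto simp: M_def)
  have \<epsilon>: "\<epsilon> > 0" and \<alpha>: "\<alpha> > 0"
    using M assms by (auto simp: \<epsilon>_def)
  have "1 - 4 * \<epsilon> - \<gamma> = (1 - M) / 4" by (simp add: \<epsilon>_def \<gamma>_def field_simps)
  then have "\<gamma> < 1 - 4 * \<epsilon>" using M by simp
  moreover have "M < \<gamma>" "0 < \<gamma>" "2 * \<alpha> < \<gamma>" using M assms by (auto simp: \<gamma>_def)
  ultimately have \<gamma>: "M < \<gamma>" "0 < \<gamma>" "0 < M" "\<gamma> < 1 - 4 * \<epsilon>" "2 * \<alpha> < \<gamma>" using M by auto
  show ?thesis
  proof (rule exI[of _ \<epsilon>], intro conjI \<epsilon> allI impI)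
    fix c1 c2 :: real assume "0 < c1 \<and> c1 \<le> c2"
    then have c: "0 < c1" "0 < c2" by auto
    \<comment> \<open>This is the condition on \<open>t + \<kappa>\<close> for
      \<open>d = \<epsilon> * log 2 n\<close>. The right side is
      \<open>n powr (1 - 4 * \<epsilon>)\<close> up to logarithmic factors.\<close>
    have "\<forall>\<^sub>F n::nat in sequentially. real n powr \<gamma> + (real n powr M + log 2 n)
        \<le> real n powr (- 4 * \<epsilon>) * ((3 / 4 * real n - \<epsilon> * log 2 n) / (4 * (\<epsilon> * log 2 n)\<^sup>2 + 1)) / 4"
      using \<gamma> \<epsilon> by real_asymp
    moreover have "\<forall>\<^sub>F n::nat in sequentially. 4 * (\<epsilon> * log 2 n) < c1 * real n powr \<alpha>"
      using \<epsilon> \<alpha> c by real_asymp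
    \<comment> \<open>Forces the prime \<open>p\<close> to be odd.\<close>
    moreover have "\<forall>\<^sub>F n::nat in sequentially. 3 \<le> c1 * real n powr \<alpha>"
      using \<alpha> c by real_asymp
    moreover have "\<forall>\<^sub>F n::nat in sequentially. 1 / (2 * (c1 * real n powr \<alpha>)) \<le> 1 / log 2 n"
      using \<alpha> c by real_asymp
    moreover have "\<forall>\<^sub>F n::nat in sequentially.
        2 * (c2 * real n powr \<alpha>) * exp (- (real n powr \<gamma>) / (16 * (c2 * real n powr \<alpha>)\<^sup>2)) \<le> 1 / log 2 n"
      using \<alpha> \<gamma> c by real_asymp
    moreover have "\<forall>\<^sub>F n::nat in sequentially. 1 / real n \<le> 1 / log 2 n"
      by real_asymp
    moreover have "\<forall>\<^sub>F n::nat in sequentially. exp (- (real n powr \<gamma>)) \<le> 1 / log 2 n"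
      using \<gamma> by real_asymp
    moreover have "\<forall>\<^sub>F n::nat in sequentially. 2 \<le> n" by (rule eventually_ge_at_top)
    ultimately have "\<forall>\<^sub>F n::nat in sequentially. \<forall>p::nat. \<forall>l::nat. \<forall>f.
        prime p \<and> c1 * real n powr \<alpha> \<le> real p \<and> real p \<le> c2 * real n powr \<alpha> \<and>
        real l \<le> real n + real n powr \<delta> \<and> is_local (\<epsilon> * log 2 (real n)) l (n + 1) f \<longrightarrow>
        tv_dist (map_pmf f (uniform_bits l))
                (map_pmf (\<lambda>x. x @ [majmod p x \<noteq> parity x]) (uniform_bits n))
          \<ge> 1 / 2 - 4 / log 2 (real n)"
    proof eventually_elim
      case (elim n)
      define d where "d = \<epsilon> * log 2 n"
      \<comment> \<open>The power covers the seed surplus \<open>n powr \<delta>\<close>; the added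
        logarithm leaves a support error of at most \<open>1 / n\<close>.\<close>
      define \<kappa> where "\<kappa> = real n powr M + log 2 n"
      define s where "s = (3 / 4 * real n - d) / (4 * d\<^sup>2 + 1)"
      have log: "log 2 n > 0" using elim(8) by simp
      have q: "2 powr (- 4 * d) = real n powr (- 4 * \<epsilon>)"
      proof -
        have "2 powr (- 4 * d) = (2 powr log 2 n) powr (- 4 * \<epsilon>)"
          by (simp only: powr_powr) (simp add: d_def mult_ac)
        then show ?thesis using elim(8) by simp
      qed
      have t: "real n powr \<gamma> + \<kappa> \<le> 2 powr (- 4 * d) * s / 4"
        unfolding q unfolding \<kappa>_def s_def d_def by (rule elim(1))
      show ?case
      proof (intro allI impI, elim conjE)
        fix p l :: nat and f
        assume p: "prime p" "c1 * real n powr \<alpha> \<le> real p" "real p \<le> c2 * real n powr \<alpha>"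
          and l: "real l \<le> real n + real n powr \<delta>" and loc: "is_local (\<epsilon> * log 2 (real n)) l (n + 1) f"
        let ?tv = "tv_dist (map_pmf f (uniform_bits l))
          (map_pmf (\<lambda>x. x @ [majmod p x \<noteq> parity x]) (uniform_bits n))"
        show "?tv \<ge> 1 / 2 - 4 / log 2 (real n)"
        proof (cases "l < n")
          case True
          then have "1 / 2 \<le> ?tv" by (rule tv_dist_short_seed)
          moreover have "0 \<le> 4 / log 2 (real n)" using log by simp
          ultimately show ?thesis by linarith
        next
          case False
          have p3: "real p \<ge> 3" using elim(3) p(2) by linarith
          then have "odd p" using p(1) by (intro prime_odd_nat) auto
          then have tv: "1 / 2 - 1 / (2 * p) - 2 * p * exp (- (real n powr \<gamma>) / (16 * p\<^sup>2))
              - 2 powr (real l - n - \<kappa>) - exp (- (2 powr (- 4 * d)) * s / 4) \<le> ?tv"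
            unfolding s_def
            using loc False p elim(2) \<epsilon> log t
            by (intro tv_dist_local_ge) (auto simp: d_def s_def)
          have "1 / (2 * real p) \<le> 1 / (2 * (c1 * real n powr \<alpha>))"
            using p(2) elim(3) by (intro frac_le) auto
          then have e1: "1 / (2 * real p) \<le> 1 / log 2 n" using elim(4) by linarith
          have "2 * real p * exp (- (real n powr \<gamma>) / (16 * p\<^sup>2))
              \<le> 2 * (c2 * real n powr \<alpha>) * exp (- (real n powr \<gamma>) / (16 * (c2 * real n powr \<alpha>)\<^sup>2))"
          proof (intro mult_mono)
            have "(real p)\<^sup>2 \<le> (c2 * real n powr \<alpha>)\<^sup>2" using p(3) by (intro power_mono) auto
            then have "real n powr \<gamma> / (16 * (c2 * real n powr \<alpha>)\<^sup>2) \<le> real n powr \<gamma> / (16 * p\<^sup>2)"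
              using p3 by (intro frac_le) auto
            then show "exp (- (real n powr \<gamma>) / (16 * p\<^sup>2)) \<le> exp (- (real n powr \<gamma>) / (16 * (c2 * real n powr \<alpha>)\<^sup>2))"
              by simp
          qed (use p c in auto)
          then have e2: "2 * real p * exp (- (real n powr \<gamma>) / (16 * p\<^sup>2)) \<le> 1 / log 2 n"
            using elim(5) by linarith
          have "real n powr \<delta> \<le> real n powr M" using M(1) elim(8) by (intro powr_mono) auto
          then have "2 powr (real l - n - \<kappa>) \<le> 2 powr (- log 2 n)" using l by (simp add: \<kappa>_def)
          also have "\<dots> = 1 / n" using elim(8) by (simp add: powr_minus inverse_eq_divide)
          finally have e3: "2 powr (real l - n - \<kappa>) \<le> 1 / log 2 n" using elim(6) by linarith
          have "\<kappa> \<ge> 0" using log by (simp add: \<kappa>_def)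
          then have "exp (- (2 powr (- 4 * d)) * s / 4) \<le> exp (- (real n powr \<gamma>))"
            using t by simp
          then have e4: "exp (- (2 powr (- 4 * d)) * s / 4) \<le> 1 / log 2 n" using elim(7) by linarith
          \<comment> \<open>Four errors of at most \<open>1 / log 2 n\<close> each account for the
            constant \<open>4\<close>.\<close>
          show ?thesis using tv e1 e2 e3 e4 by (simp add: field_simps)
        qed
      qed
    qed
    then obtain n0 where "\<forall>n\<ge>n0. \<forall>p::nat. \<forall>l::nat. \<forall>f.
        prime p \<and> c1 * real n powr \<alpha> \<le> real p \<and> real p \<le> c2 * real n powr \<alpha> \<and>
        real l \<le> real n + real n powr \<delta> \<and> is_local (\<epsilon> * log 2 (real n)) l (n + 1) f \<longrightarrow>
        tv_dist (map_pmf f (uniform_bits l))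
                (map_pmf (\<lambda>x. x @ [majmod p x \<noteq> parity x]) (uniform_bits n))
          \<ge> 1 / 2 - 4 / log 2 (real n)"
      unfolding eventually_sequentially by blast
    then show "\<exists>C>0. \<exists>n0::nat. \<forall>n \<ge> n0. \<forall>p::nat. \<forall>l::nat. \<forall>f.
        prime p \<and> c1 * real n powr \<alpha> \<le> real p \<and> real p \<le> c2 * real n powr \<alpha> \<and>
        real l \<le> real n + real n powr \<delta> \<and> is_local (\<epsilon> * log 2 (real n)) l (n + 1) f \<longrightarrow>
        tv_dist (map_pmf f (uniform_bits l))
                (map_pmf (\<lambda>x. x @ [majmod p x \<noteq> parity x]) (uniform_bits n))
          \<ge> 1 / 2 - C / log 2 (real n)"
      by (intro exI[of _ 4] exI[of _ n0] conjI) simp_all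
  qed
qed

end
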